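(* Let $L$ be a lattice with minimum $\widehat 0$ and maximum $\widehat 1$, and let $G$ be a group of automorphisms of $L$. Let $C$ be a $G$-stable cross-cut of $L$. Then for every $i$ there is an isomorphism of $\mathbb{C}[G]$-modules $$\widetilde{H}_{i}(L)\simeq_{G}\widetilde{H}_{i}(C).$$
   Context: A cross-cut of $L$ is a set $C\subseteq L$ such that: (i) $\widehat 0,\widehat 1\notin C$; (ii) any two distinct elements of $C$ are incomparable; (iii) any finite chain $x_1<x_2<\dots<x_n$ in $L$ can be extended to a chain which contains an element of $C$. The cross-cut $C$ is $G$-stable if $g(C)=C$ for all $g\in G$. A finite subset $\{x_1,\dots,x_n\}\subseteq C$ "spans" if $x_1\wedge\dots\wedge x_n=\widehat 0$ and $x_1\vee\dots\vee x_n=\widehat 1$. $K(C)$ is the abstract simplicial complex with vertex set $C$ whose simplices are all finite subsets of $C$ which do not span, and $\widetilde{H}_i(C)=\widetilde{H}_i(K(C),\mathbb{C})$. $\widetilde{H}_i(L)=\widetilde{H}_i(K(L),\mathbb{C})$, where $K(L)$ is the order complex of $L$, i.e. the simplicial complex of finite chains of $L\smallsetminus\{\widehat 0,\widehat 1\}$. $G$ acts on both complexes by simplicial automorphisms (through its action on elements of $L$), on oriented simplices by $g[x_0,\dots,x_i]=[g(x_0),\dots,g(x_i)]$, and hence on reduced homology. *)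

theory Defs
  imports
    Complex_Main
    "HOL-Library.Function_Algebras"
    "HOL-Combinatorics.Permutations"
    "HOL-Algebra.Module"
begin

section \<open>Left modules and the complex group algebra\<close>

text \<open>The locale \<open>module\<close> of HOL-Algebra requires a commutative ring of scalars.\<close>

locale left_module = R?: ring R + M?: abelian_group M for R (structure) and M (structure) +
  assumes smult_closed:
      "\<lbrakk>a \<in> carrier R; x \<in> carrier M\<rbrakk> \<Longrightarrow> a \<odot>\<^bsub>M\<^esub> x \<in> carrier M"
    and smult_l_distr:
      "\<lbrakk>a \<in> carrier R; b \<in> carrier R; x \<in> carrier M\<rbrakk> \<Longrightarrow>
        (a \<oplus>\<^bsub>R\<^esub> b) \<odot>\<^bsub>M\<^esub> x = a \<odot>\<^bsub>M\<^esub> x \<oplus>\<^bsub>M\<^esub> b \<odot>\<^bsub>M\<^esub> x"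
    and smult_r_distr:
      "\<lbrakk>a \<in> carrier R; x \<in> carrier M; y \<in> carrier M\<rbrakk> \<Longrightarrow>
        a \<odot>\<^bsub>M\<^esub> (x \<oplus>\<^bsub>M\<^esub> y) = a \<odot>\<^bsub>M\<^esub> x \<oplus>\<^bsub>M\<^esub> a \<odot>\<^bsub>M\<^esub> y"
    and smult_assoc:
      "\<lbrakk>a \<in> carrier R; b \<in> carrier R; x \<in> carrier M\<rbrakk> \<Longrightarrow>
        (a \<otimes>\<^bsub>R\<^esub> b) \<odot>\<^bsub>M\<^esub> x = a \<odot>\<^bsub>M\<^esub> (b \<odot>\<^bsub>M\<^esub> x)"
    and smult_one: "x \<in> carrier M \<Longrightarrow> \<one>\<^bsub>R\<^esub> \<odot>\<^bsub>M\<^esub> x = x"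

definition left_module_iso ::
    "('r, 's) ring_scheme \<Rightarrow> ('r, 'm, 'x) module_scheme \<Rightarrow> ('r, 'n, 'y) module_scheme \<Rightarrow> ('m \<Rightarrow> 'n) set"
  where "left_module_iso R M N =
    {\<phi>. bij_betw \<phi> (carrier M) (carrier N) \<and>
         (\<forall>x\<in>carrier M. \<forall>y\<in>carrier M. \<phi> (x \<oplus>\<^bsub>M\<^esub> y) = \<phi> x \<oplus>\<^bsub>N\<^esub> \<phi> y) \<and>
         (\<forall>a\<in>carrier R. \<forall>x\<in>carrier M. \<phi> (a \<odot>\<^bsub>M\<^esub> x) = a \<odot>\<^bsub>N\<^esub> \<phi> x)}"

definition group_algebra :: "('g, 'x) monoid_scheme \<Rightarrow> ('g \<Rightarrow> complex) ring" where
  "group_algebra \<Gamma> =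
    \<lparr>carrier = {a. finite {g. a g \<noteq> 0} \<and> {g. a g \<noteq> 0} \<subseteq> carrier \<Gamma>},
     mult = (\<lambda>a b g. \<Sum>h | a h \<noteq> 0. \<Sum>k | b k \<noteq> 0 \<and> h \<otimes>\<^bsub>\<Gamma>\<^esub> k = g. a h * b k),
     one = (\<lambda>g. if g = \<one>\<^bsub>\<Gamma>\<^esub> then 1 else 0),
     zero = 0,
     add = (+)\<rparr>"

text \<open>The quotient of \<open>Z\<close> by \<open>B\<close>, with scalars acting through \<open>act\<close>.  The fields \<open>mult\<close> and
  \<open>one\<close> are inherited from the record type of rings and have no meaning for a module.\<close>

definition quot_rel :: "'m::ab_group_add set \<Rightarrow> 'm set \<Rightarrow> ('m \<times> 'm) set" where
  "quot_rel Z B = {(x, y). x \<in> Z \<and> y \<in> Z \<and> x - y \<in> B}"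

definition quotient_module ::
    "'m::ab_group_add set \<Rightarrow> 'm set \<Rightarrow> ('r \<Rightarrow> 'm \<Rightarrow> 'm) \<Rightarrow> ('r, 'm set) module" where
  "quotient_module Z B act =
    \<lparr>carrier = Z // quot_rel Z B,
     mult = undefined,
     one = undefined,
     zero = quot_rel Z B `` {0},
     add = (\<lambda>X Y. \<Union>x\<in>X. \<Union>y\<in>Y. quot_rel Z B `` {x + y}),
     smult = (\<lambda>a X. \<Union>x\<in>X. quot_rel Z B `` {act a x})\<rparr>"


section \<open>Reduced homology of an abstract simplicial complex\<close>

text \<open>A complex is given by its set of simplices, the empty simplex included.\<close>

definition simplicial_complex :: "'v set set \<Rightarrow> bool" where
  "simplicial_complex K \<longleftrightarrow>
    {} \<in> K \<and> (\<forall>\<sigma>\<in>K. finite \<sigma>) \<and> (\<forall>\<sigma>\<in>K. \<forall>\<tau>. \<tau> \<subseteq> \<sigma> \<longrightarrow> \<tau> \<in> K)"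

text \<open>Oriented chains with complex coefficients: finitely supported functions on the orderings
  of the \<open>i\<close>-simplices which change sign when two vertices are exchanged, i.e. functions on
  oriented simplices taking opposite values on opposite orientations.  The empty list is
  the only ordered simplex of degree \<open>-1\<close>, so the complex is the augmented one.\<close>

type_synonym 'v chain = "'v list \<Rightarrow> complex"

definition oriented_chains :: "'v set set \<Rightarrow> int \<Rightarrow> 'v chain set" where
  "oriented_chains K i =
    {c. finite {xs. c xs \<noteq> 0} \<and>
        (\<forall>xs. c xs \<noteq> 0 \<longrightarrow> distinct xs \<and> set xs \<in> K \<and> int (length xs) = i + 1) \<and>
        (\<forall>xs j k. j < k \<and> k < length xs \<longrightarrow> c (xs[j := xs ! k, k := xs ! j]) = - c xs)}"

text \<open>The chain \<open>[x\<^sub>0, \<dots>, x\<^sub>i]\<close> of a single oriented simplex.\<close>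

definition oriented_simplex :: "'v list \<Rightarrow> 'v chain" where
  "oriented_simplex xs =
    (\<lambda>ys. \<Sum>p | p permutes {..<length xs} \<and> permute_list p xs = ys. of_int (sign p))"

text \<open>On oriented simplices this is
  \<open>\<partial>[x\<^sub>0, \<dots>, x\<^sub>i] = (\<Sum>j. (-1)^j [x\<^sub>0, \<dots>, x\<^sub>j\<^sub>-\<^sub>1, x\<^sub>j\<^sub>+\<^sub>1, \<dots>, x\<^sub>i])\<close>, see \<open>boundary_oriented_simplex\<close> below;
  in degree \<open>0\<close> it is the augmentation.\<close>

definition boundary :: "'v chain \<Rightarrow> 'v chain" where
  "boundary c = (\<lambda>ys. \<Sum>v | c (v # ys) \<noteq> 0. c (v # ys))"

definition cycles :: "'v set set \<Rightarrow> int \<Rightarrow> 'v chain set" where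
  "cycles K i = {c \<in> oriented_chains K i. boundary c = 0}"

definition boundaries :: "'v set set \<Rightarrow> int \<Rightarrow> 'v chain set" where
  "boundaries K i = boundary ` oriented_chains K (i + 1)"

text \<open>A permutation of the vertices acts by \<open>g[x\<^sub>0, \<dots>, x\<^sub>i] = [g x\<^sub>0, \<dots>, g x\<^sub>i]\<close>, see
  \<open>chain_act_oriented_simplex\<close> below, and elements of the group algebra act by linear extension.\<close>

definition chain_act :: "('v \<Rightarrow> 'v) \<Rightarrow> 'v chain \<Rightarrow> 'v chain" where
  "chain_act g c = (\<lambda>xs. c (map (inv_into UNIV g) xs))"

definition algebra_act :: "(('v \<Rightarrow> 'v) \<Rightarrow> complex) \<Rightarrow> 'v chain \<Rightarrow> 'v chain" where
  "algebra_act a c = (\<lambda>xs. \<Sum>g | a g \<noteq> 0. a g * chain_act g c xs)"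

definition reduced_homology ::
    "'v set set \<Rightarrow> int \<Rightarrow> (('v \<Rightarrow> 'v) \<Rightarrow> complex, 'v chain set) module" where
  "reduced_homology K i = quotient_module (cycles K i) (boundaries K i) algebra_act"


section \<open>Lattice automorphisms, order complexes and cross-cuts\<close>

definition lattice_Aut :: "('a::lattice \<Rightarrow> 'a) monoid" where
  "lattice_Aut =
    \<lparr>carrier = {g. bij g \<and> (\<forall>x y. g (inf x y) = inf (g x) (g y)) \<and>
                          (\<forall>x y. g (sup x y) = sup (g x) (g y))},
     mult = (\<circ>),
     one = id\<rparr>"

definition order_complex :: "'a::bounded_lattice set set" where
  "order_complex = {\<sigma>. finite \<sigma> \<and> Orderings.bot \<notin> \<sigma> \<and> Orderings.top \<notin> \<sigma> \<and> Complete_Partial_Order.chain (\<le>) \<sigma>}"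

definition crosscut :: "'a::bounded_lattice set \<Rightarrow> bool" where
  "crosscut C \<longleftrightarrow>
    Orderings.bot \<notin> C \<and> Orderings.top \<notin> C \<and>
    (\<forall>x\<in>C. \<forall>y\<in>C. x \<noteq> y \<longrightarrow> \<not> x \<le> y \<and> \<not> y \<le> x) \<and>
    (\<forall>X. finite X \<and> Complete_Partial_Order.chain (\<le>) X \<longrightarrow>
      (\<exists>Y. Complete_Partial_Order.chain (\<le>) Y \<and> X \<subseteq> Y \<and> Y \<inter> C \<noteq> {}))"

text \<open>The empty set does not span: its meet is \<open>top\<close> and its join is \<open>bot\<close>, and these differ as
  soon as there is a cross-cut.  The library operations \<^const>\<open>Inf_fin\<close> and \<^const>\<open>Sup_fin\<close> are
  unspecified on the empty set.\<close>

definition spans :: "'a::bounded_lattice set \<Rightarrow> bool" where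
  "spans S \<longleftrightarrow> S \<noteq> {} \<and> Inf_fin S = Orderings.bot \<and> Sup_fin S = Orderings.top"

definition crosscut_complex :: "'a::bounded_lattice set \<Rightarrow> 'a set set" where
  "crosscut_complex C = {S. finite S \<and> S \<subseteq> C \<and> \<not> spans S}"


section \<open>Basic properties\<close>

subsection \<open>The group algebra\<close>

definition lin_ext :: "('g \<Rightarrow> complex) \<Rightarrow> ('g \<Rightarrow> complex) \<Rightarrow> complex" where
  "lin_ext a F = (\<Sum>g | a g \<noteq> 0. a g * F g)"

lemma lin_ext_superset:
  assumes "finite S" "{g. a g \<noteq> 0} \<subseteq> S"
  shows "lin_ext a F = (\<Sum>g\<in>S. a g * F g)"
  unfolding lin_ext_def by (rule sum.mono_neutral_left) (use assms in auto)

lemma lin_ext_add_right: "lin_ext a (\<lambda>g. F g + H g) = lin_ext a F + lin_ext a H"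
  by (simp add: lin_ext_def algebra_simps sum.distrib)

lemma lin_ext_add_left:
  assumes "finite {g. a g \<noteq> 0}" "finite {g. b g \<noteq> 0}"
  shows "lin_ext (a + b) F = lin_ext a F + lin_ext b F"
proof -
  let ?S = "{g. a g \<noteq> 0} \<union> {g. b g \<noteq> 0}"
  have f: "finite ?S" using assms by simp
  have "lin_ext (a + b) F = (\<Sum>g\<in>?S. (a + b) g * F g)"
    by (rule lin_ext_superset) (use f in auto)
  also have "\<dots> = (\<Sum>g\<in>?S. a g * F g) + (\<Sum>g\<in>?S. b g * F g)"
    by (simp add: algebra_simps sum.distrib)
  also have "(\<Sum>g\<in>?S. a g * F g) = lin_ext a F"
    by (rule lin_ext_superset[symmetric]) (use f in auto)
  also have "(\<Sum>g\<in>?S. b g * F g) = lin_ext b F"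
    by (rule lin_ext_superset[symmetric]) (use f in auto)
  finally show ?thesis .
qed

lemma lin_ext_cong:
  "(\<And>g. a g \<noteq> 0 \<Longrightarrow> F g = H g) \<Longrightarrow> lin_ext a F = lin_ext a H"
  unfolding lin_ext_def by (rule sum.cong) auto

lemma lin_ext_one: "lin_ext (\<lambda>g. if g = e then 1 else 0) F = F e"
  by (simp add: lin_ext_def)

lemma mult_group_algebra:
  assumes "finite {g. b g \<noteq> 0}"
  shows "(a \<otimes>\<^bsub>group_algebra \<Gamma>\<^esub> b) g =
    lin_ext a (\<lambda>h. lin_ext b (\<lambda>k. of_bool (h \<otimes>\<^bsub>\<Gamma>\<^esub> k = g)))"
proof -
  have "(\<Sum>k | b k \<noteq> 0 \<and> h \<otimes>\<^bsub>\<Gamma>\<^esub> k = g. a h * b k) =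
      a h * lin_ext b (\<lambda>k. of_bool (h \<otimes>\<^bsub>\<Gamma>\<^esub> k = g))" for h
  proof -
    have "(\<Sum>k | b k \<noteq> 0 \<and> h \<otimes>\<^bsub>\<Gamma>\<^esub> k = g. a h * b k) =
        (\<Sum>k | b k \<noteq> 0. a h * (b k * of_bool (h \<otimes>\<^bsub>\<Gamma>\<^esub> k = g)))"
      by (rule sum.mono_neutral_cong_left) (use assms in auto)
    then show ?thesis by (simp add: lin_ext_def sum_distrib_left)
  qed
  then show ?thesis by (simp add: group_algebra_def lin_ext_def)
qed

lemma mult_support:
  assumes "finite {g. b g \<noteq> 0}"
  shows "{g. (a \<otimes>\<^bsub>group_algebra \<Gamma>\<^esub> b) g \<noteq> 0} \<subseteq>
    (\<lambda>(h, k). h \<otimes>\<^bsub>\<Gamma>\<^esub> k) ` ({g. a g \<noteq> 0} \<times> {g. b g \<noteq> 0})"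
proof
  fix g assume "g \<in> {g. (a \<otimes>\<^bsub>group_algebra \<Gamma>\<^esub> b) g \<noteq> 0}"
  then have "(\<Sum>h | a h \<noteq> 0. \<Sum>k | b k \<noteq> 0 \<and> h \<otimes>\<^bsub>\<Gamma>\<^esub> k = g. a h * b k) \<noteq> 0"
    by (simp add: group_algebra_def)
  then obtain h where h: "a h \<noteq> 0" "(\<Sum>k | b k \<noteq> 0 \<and> h \<otimes>\<^bsub>\<Gamma>\<^esub> k = g. a h * b k) \<noteq> 0"
    by (rule sum.not_neutral_contains_not_neutral) auto
  from h(2) obtain k where "b k \<noteq> 0" "h \<otimes>\<^bsub>\<Gamma>\<^esub> k = g"
    by (rule sum.not_neutral_contains_not_neutral) auto
  with h show "g \<in> (\<lambda>(h, k). h \<otimes>\<^bsub>\<Gamma>\<^esub> k) ` ({g. a g \<noteq> 0} \<times> {g. b g \<noteq> 0})"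
    by force
qed

lemma lin_ext_mult:
  assumes a: "finite {g. a g \<noteq> 0}" and b: "finite {g. b g \<noteq> 0}"
  shows "lin_ext (a \<otimes>\<^bsub>group_algebra \<Gamma>\<^esub> b) F = lin_ext a (\<lambda>h. lin_ext b (\<lambda>k. F (h \<otimes>\<^bsub>\<Gamma>\<^esub> k)))"
proof -
  let ?P = "(\<lambda>(h, k). h \<otimes>\<^bsub>\<Gamma>\<^esub> k) ` ({g. a g \<noteq> 0} \<times> {g. b g \<noteq> 0})"
  have P: "finite ?P" using a b by simp
  have "lin_ext (a \<otimes>\<^bsub>group_algebra \<Gamma>\<^esub> b) F = (\<Sum>g\<in>?P. (a \<otimes>\<^bsub>group_algebra \<Gamma>\<^esub> b) g * F g)"
    by (rule lin_ext_superset[OF P mult_support[OF b]])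
  also have "\<dots> = (\<Sum>g\<in>?P. \<Sum>h | a h \<noteq> 0. \<Sum>k | b k \<noteq> 0.
      a h * (b k * (of_bool (h \<otimes>\<^bsub>\<Gamma>\<^esub> k = g) * F g)))"
    by (simp add: mult_group_algebra[OF b] lin_ext_def sum_distrib_left sum_distrib_right mult.assoc)
  also have "\<dots> = (\<Sum>h | a h \<noteq> 0. \<Sum>g\<in>?P. \<Sum>k | b k \<noteq> 0.
      a h * (b k * (of_bool (h \<otimes>\<^bsub>\<Gamma>\<^esub> k = g) * F g)))"
    by (rule sum.swap)
  also have "\<dots> = (\<Sum>h | a h \<noteq> 0. \<Sum>k | b k \<noteq> 0. \<Sum>g\<in>?P.
      a h * (b k * (of_bool (h \<otimes>\<^bsub>\<Gamma>\<^esub> k = g) * F g)))"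
    by (intro sum.cong refl sum.swap)
  also have "\<dots> = (\<Sum>h | a h \<noteq> 0. \<Sum>k | b k \<noteq> 0. a h * (b k * F (h \<otimes>\<^bsub>\<Gamma>\<^esub> k)))"
  proof (intro sum.cong refl)
    fix h k assume hk: "h \<in> {h. a h \<noteq> 0}" "k \<in> {k. b k \<noteq> 0}"
    then have "h \<otimes>\<^bsub>\<Gamma>\<^esub> k \<in> ?P" by force
    then have "(\<Sum>g\<in>?P. of_bool (h \<otimes>\<^bsub>\<Gamma>\<^esub> k = g) * F g) = F (h \<otimes>\<^bsub>\<Gamma>\<^esub> k)"
      using P by (simp add: of_bool_def if_distrib[of "\<lambda>x. x * _"] sum.delta cong: if_cong)
    then show "(\<Sum>g\<in>?P. a h * (b k * (of_bool (h \<otimes>\<^bsub>\<Gamma>\<^esub> k = g) * F g))) =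
        a h * (b k * F (h \<otimes>\<^bsub>\<Gamma>\<^esub> k))"
      by (simp only: sum_distrib_left[symmetric])
  qed
  also have "\<dots> = lin_ext a (\<lambda>h. lin_ext b (\<lambda>k. F (h \<otimes>\<^bsub>\<Gamma>\<^esub> k)))"
    by (simp add: lin_ext_def sum_distrib_left)
  finally show ?thesis .
qed

lemma carrier_group_algebra:
  "a \<in> carrier (group_algebra \<Gamma>) \<longleftrightarrow> finite {g. a g \<noteq> 0} \<and> {g. a g \<noteq> 0} \<subseteq> carrier \<Gamma>"
  by (simp add: group_algebra_def)

lemma ring_group_algebra:
  assumes "monoid \<Gamma>"
  shows "ring (group_algebra \<Gamma>)"
proof -
  interpret monoid \<Gamma> by fact
  let ?R = "group_algebra \<Gamma>"
  have sel [simp]: "\<zero>\<^bsub>?R\<^esub> = 0" "a \<oplus>\<^bsub>?R\<^esub> b = a + b"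
      "\<one>\<^bsub>?R\<^esub> = (\<lambda>g. if g = \<one>\<^bsub>\<Gamma>\<^esub> then 1 else 0)" for a b
    by (simp_all add: group_algebra_def)
  note car = carrier_group_algebra
  have add: "a + b \<in> carrier ?R" if "a \<in> carrier ?R" "b \<in> carrier ?R" for a b
  proof -
    have "{g. (a + b) g \<noteq> 0} \<subseteq> {g. a g \<noteq> 0} \<union> {g. b g \<noteq> 0}" by auto
    then show ?thesis
      using that unfolding car by (meson Un_least finite_Un finite_subset subset_trans)
  qed
  have ab: "abelian_group ?R"
  proof (rule abelian_groupI, goal_cases)
    case 1
    then show ?case by (simp add: add)
  next
    case (6 a)
    have "- a \<in> carrier ?R" using 6 by (simp add: car)
    then show ?case by (intro bexI[of _ "- a"]) auto
  qed (auto simp: add.assoc add.commute car)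
  have mult: "a \<otimes>\<^bsub>?R\<^esub> b \<in> carrier ?R" if a: "a \<in> carrier ?R" and b: "b \<in> carrier ?R" for a b
  proof -
    have fin: "finite {g. b g \<noteq> 0}" using b by (simp add: car)
    have "finite ((\<lambda>(h, k). h \<otimes>\<^bsub>\<Gamma>\<^esub> k) ` ({g. a g \<noteq> 0} \<times> {g. b g \<noteq> 0}))"
      using a b by (simp add: car)
    moreover have "(\<lambda>(h, k). h \<otimes>\<^bsub>\<Gamma>\<^esub> k) ` ({g. a g \<noteq> 0} \<times> {g. b g \<noteq> 0}) \<subseteq> carrier \<Gamma>"
      using a b by (auto simp: car)
    ultimately show ?thesis
      using mult_support[OF fin, where a = a and \<Gamma> = \<Gamma>] unfolding car by (meson finite_subset subset_trans)
  qed
  have finb: "finite {g. b g \<noteq> 0}" if "b \<in> carrier ?R" for b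
    using that by (simp add: car)
  have carD: "g \<in> carrier \<Gamma>" if "b \<in> carrier ?R" "b g \<noteq> 0" for b g
    using that by (auto simp: car)
  have one: "(\<lambda>g. if g = \<one>\<^bsub>\<Gamma>\<^esub> then 1 else 0) \<in> carrier ?R"
    by (auto simp: car)
  have mon: "monoid ?R"
  proof (rule monoidI, goal_cases)
    case (3 a b c)
    show ?case
    proof
      fix g
      have "(a \<otimes>\<^bsub>?R\<^esub> b \<otimes>\<^bsub>?R\<^esub> c) g =
          lin_ext a (\<lambda>h. lin_ext b (\<lambda>k. lin_ext c (\<lambda>u. of_bool (h \<otimes>\<^bsub>\<Gamma>\<^esub> k \<otimes>\<^bsub>\<Gamma>\<^esub> u = g))))"
        using 3 by (simp add: mult_group_algebra finb lin_ext_mult)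
      also have "\<dots> =
          lin_ext a (\<lambda>h. lin_ext b (\<lambda>k. lin_ext c (\<lambda>u. of_bool (h \<otimes>\<^bsub>\<Gamma>\<^esub> (k \<otimes>\<^bsub>\<Gamma>\<^esub> u) = g))))"
        using 3 by (intro lin_ext_cong) (simp add: m_assoc carD)
      also have "\<dots> = (a \<otimes>\<^bsub>?R\<^esub> (b \<otimes>\<^bsub>?R\<^esub> c)) g"
        using 3 mult by (simp add: mult_group_algebra[of "b \<otimes>\<^bsub>?R\<^esub> c"] finb lin_ext_mult)
      finally show "(a \<otimes>\<^bsub>?R\<^esub> b \<otimes>\<^bsub>?R\<^esub> c) g = (a \<otimes>\<^bsub>?R\<^esub> (b \<otimes>\<^bsub>?R\<^esub> c)) g" .
    qed
  next
    case (4 a)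
    show ?case
    proof
      fix g
      have "(\<one>\<^bsub>?R\<^esub> \<otimes>\<^bsub>?R\<^esub> a) g = lin_ext a (\<lambda>k. of_bool (\<one>\<^bsub>\<Gamma>\<^esub> \<otimes>\<^bsub>\<Gamma>\<^esub> k = g))"
        using 4 by (simp add: mult_group_algebra finb lin_ext_one)
      also have "\<dots> = lin_ext a (\<lambda>k. of_bool (k = g))"
        using 4 by (intro lin_ext_cong) (simp add: carD)
      also have "\<dots> = a g"
        using finb[OF 4] by (simp add: lin_ext_def of_bool_def if_distrib cong: if_cong)
      finally show "(\<one>\<^bsub>?R\<^esub> \<otimes>\<^bsub>?R\<^esub> a) g = a g" .
    qed
  next
    case (5 a)
    show ?case
    proof
      fix g
      have f: "finite {g. (\<one>\<^bsub>?R\<^esub>) g \<noteq> 0}" using finb[OF one] by simp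
      have "(a \<otimes>\<^bsub>?R\<^esub> \<one>\<^bsub>?R\<^esub>) g = lin_ext a (\<lambda>k. of_bool (k \<otimes>\<^bsub>\<Gamma>\<^esub> \<one>\<^bsub>\<Gamma>\<^esub> = g))"
        unfolding mult_group_algebra[OF f] by (simp add: lin_ext_one)
      also have "\<dots> = lin_ext a (\<lambda>k. of_bool (k = g))"
        using 5 by (intro lin_ext_cong) (simp add: carD)
      also have "\<dots> = a g"
        using finb[OF 5] by (simp add: lin_ext_def of_bool_def if_distrib cong: if_cong)
      finally show "(a \<otimes>\<^bsub>?R\<^esub> \<one>\<^bsub>?R\<^esub>) g = a g" .
    qed
  qed (use mult one in auto)
  show ?thesis
  proof (rule ringI[OF ab mon], goal_cases)
    case (1 a b c)
    then show ?case
      by (intro ext) (simp add: mult_group_algebra finb lin_ext_add_left)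
  next
    case (2 a b c)
    then have "finite {g. (a + b) g \<noteq> 0}" by (intro finb add)
    with 2 show ?case
      by (intro ext) (simp add: mult_group_algebra[of "a + b"] mult_group_algebra finb
          lin_ext_add_left lin_ext_add_right del: plus_fun_apply add: plus_fun_apply[of "_ \<otimes>\<^bsub>?R\<^esub> _"])
  qed
qed


subsection \<open>Quotient modules\<close>

lemma left_module_quotient_module:
  fixes Z B :: "'m::ab_group_add set"
  assumes "ring R"
    and Z: "0 \<in> Z" "\<And>x y. x \<in> Z \<Longrightarrow> y \<in> Z \<Longrightarrow> x - y \<in> Z"
    and B: "B \<subseteq> Z" "0 \<in> B" "\<And>x y. x \<in> B \<Longrightarrow> y \<in> B \<Longrightarrow> x - y \<in> B"
    and closed: "\<And>a x. a \<in> carrier R \<Longrightarrow> x \<in> Z \<Longrightarrow> act a x \<in> Z"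
      "\<And>a x. a \<in> carrier R \<Longrightarrow> x \<in> B \<Longrightarrow> act a x \<in> B"
    and diff: "\<And>a x y. a \<in> carrier R \<Longrightarrow> x \<in> Z \<Longrightarrow> y \<in> Z \<Longrightarrow> act a (x - y) = act a x - act a y"
    and plus: "\<And>a b x. a \<in> carrier R \<Longrightarrow> b \<in> carrier R \<Longrightarrow> x \<in> Z \<Longrightarrow>
      act (a \<oplus>\<^bsub>R\<^esub> b) x = act a x + act b x"
    and times: "\<And>a b x. a \<in> carrier R \<Longrightarrow> b \<in> carrier R \<Longrightarrow> x \<in> Z \<Longrightarrow>
      act (a \<otimes>\<^bsub>R\<^esub> b) x = act a (act b x)"
    and one: "\<And>x. x \<in> Z \<Longrightarrow> act \<one>\<^bsub>R\<^esub> x = x"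
  shows "left_module R (quotient_module Z B act)"
proof -
  let ?r = "quot_rel Z B" and ?M = "quotient_module Z B act"
  have Zm: "- x \<in> Z" if "x \<in> Z" for x using Z(2)[OF Z(1) that] by simp
  have Za: "x + y \<in> Z" if "x \<in> Z" "y \<in> Z" for x y using Z(2)[OF that(1) Zm[OF that(2)]] by simp
  have Bm: "- x \<in> B" if "x \<in> B" for x using B(3)[OF B(2) that] by simp
  have Ba: "x + y \<in> B" if "x \<in> B" "y \<in> B" for x y using B(3)[OF that(1) Bm[OF that(2)]] by simp
  have actp: "act a (x + y) = act a x + act a y" if "a \<in> carrier R" "x \<in> Z" "y \<in> Z" for a x y
  proof -
    have "act a (- y) = - act a y"
      using diff[OF that(1) Z(1) that(3)] diff[OF that(1) Z(1) Z(1)] by simp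
    then show ?thesis using diff[OF that(1,2) Zm[OF that(3)]] by simp
  qed
  have eq: "equiv Z ?r"
  proof (rule equivI)
    show "refl_on Z ?r" using B by (auto simp: refl_on_def quot_rel_def)
    show "?r \<subseteq> Z \<times> Z" by (auto simp: quot_rel_def)
    show "sym ?r" using Bm by (force simp: sym_def quot_rel_def)
    show "trans ?r"
    proof (rule transI)
      fix x y z assume "(x, y) \<in> ?r" "(y, z) \<in> ?r"
      then show "(x, z) \<in> ?r" using Ba[of "x - y" "y - z"] by (auto simp: quot_rel_def)
    qed
  qed
  have add: "(?r `` {x}) \<oplus>\<^bsub>?M\<^esub> (?r `` {y}) = ?r `` {x + y}" if "x \<in> Z" "y \<in> Z" for x y
  proof -
    have "congruent2 ?r ?r (\<lambda>x y. ?r `` {x + y})"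
    proof (rule congruent2I')
      fix x x' y y' assume "(x, x') \<in> ?r" "(y, y') \<in> ?r"
      then have "(x + y, x' + y') \<in> ?r"
        using Ba[of "x - x'" "y - y'"] Za by (auto simp: quot_rel_def algebra_simps)
      then show "?r `` {x + y} = ?r `` {x' + y'}" by (rule equiv_class_eq[OF eq])
    qed
    from UN_equiv_class2[OF eq eq this that] show ?thesis by (simp add: quotient_module_def)
  qed
  have smult: "a \<odot>\<^bsub>?M\<^esub> (?r `` {x}) = ?r `` {act a x}" if "a \<in> carrier R" "x \<in> Z" for a x
  proof -
    have "congruent ?r (\<lambda>x. ?r `` {act a x})"
    proof (rule congruentI)
      fix x y assume xy: "(x, y) \<in> ?r"
      then have "act a (x - y) \<in> B" using closed(2)[OF that(1)] by (simp add: quot_rel_def)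
      with xy have "(act a x, act a y) \<in> ?r"
        using that(1) closed(1) diff by (simp add: quot_rel_def)
      then show "?r `` {act a x} = ?r `` {act a y}" by (rule equiv_class_eq[OF eq])
    qed
    from UN_equiv_class[OF eq this that(2)] show ?thesis by (simp add: quotient_module_def)
  qed
  have carE: "\<exists>x\<in>Z. X = ?r `` {x}" if "X \<in> carrier ?M" for X
    using that by (auto simp: quotient_module_def quotient_def)
  have carI: "?r `` {x} \<in> carrier ?M" if "x \<in> Z" for x
    using that by (auto simp: quotient_module_def quotient_def)
  have zero: "\<zero>\<^bsub>?M\<^esub> = ?r `` {0}" by (simp add: quotient_module_def)
  have "abelian_group ?M"
  proof (rule abelian_groupI, goal_cases)
    case (6 X)
    then obtain x where "x \<in> Z" "X = ?r `` {x}" using carE by blast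
    then show ?case
      by (intro bexI[of _ "?r `` {- x}"]) (auto simp: add Zm zero carI)
  qed (auto dest!: carE simp: add Za carI zero Z(1) algebra_simps)
  then show ?thesis
    by (intro left_module.intro left_module_axioms.intro \<open>ring R\<close>)
       (auto dest!: carE simp: add smult Za carI closed(1) plus times one actp
          ring.ring_simprules[OF \<open>ring R\<close>])
qed


subsection \<open>Chains\<close>

lemma finite_heads:
  assumes "finite {xs. c xs \<noteq> 0}"
  shows "finite {v. c (v # ys) \<noteq> 0}"
proof -
  have "(\<lambda>v. v # ys) ` {v. c (v # ys) \<noteq> 0} \<subseteq> {xs. c xs \<noteq> 0}" by auto
  then show ?thesis using assms by (meson finite_imageD finite_subset inj_onI list.inject)
qed

lemma boundary_superset:
  assumes "finite S" "\<And>v. c (v # ys) \<noteq> 0 \<Longrightarrow> v \<in> S"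
  shows "boundary c ys = (\<Sum>v\<in>S. c (v # ys))"
  unfolding boundary_def by (rule sum.mono_neutral_left) (use assms in auto)

lemma boundary_diff:
  assumes "finite {xs. c xs \<noteq> 0}" "finite {xs. d xs \<noteq> 0}"
  shows "boundary (c - d) = boundary c - boundary d"
proof
  fix ys
  let ?S = "{v. c (v # ys) \<noteq> 0} \<union> {v. d (v # ys) \<noteq> 0}"
  have f: "finite ?S" using assms by (simp add: finite_heads)
  have "boundary (c - d) ys = (\<Sum>v\<in>?S. (c - d) (v # ys))"
    "boundary c ys = (\<Sum>v\<in>?S. c (v # ys))" "boundary d ys = (\<Sum>v\<in>?S. d (v # ys))"
    by (rule boundary_superset[OF f]; auto)+
  then show "boundary (c - d) ys = (boundary c - boundary d) ys"
    by (simp add: sum_subtractf)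
qed

lemma boundary_zero [simp]: "boundary 0 = 0"
  by (rule ext) (simp add: boundary_def)

lemma chains_zero [simp]: "0 \<in> oriented_chains K i"
  by (simp add: oriented_chains_def)

lemma chains_diff:
  assumes "c \<in> oriented_chains K i" "d \<in> oriented_chains K i"
  shows "c - d \<in> oriented_chains K i"
proof -
  have "{xs. (c - d) xs \<noteq> 0} \<subseteq> {xs. c xs \<noteq> 0} \<union> {xs. d xs \<noteq> 0}" by auto
  moreover have "finite ({xs. c xs \<noteq> 0} \<union> {xs. d xs \<noteq> 0})"
    using assms by (simp add: oriented_chains_def)
  ultimately have "finite {xs. (c - d) xs \<noteq> 0}" by (rule finite_subset)
  moreover have "distinct xs \<and> set xs \<in> K \<and> int (length xs) = i + 1" if "(c - d) xs \<noteq> 0" for xs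
  proof -
    from that have "c xs \<noteq> 0 \<or> d xs \<noteq> 0" by auto
    with assms show ?thesis unfolding oriented_chains_def by blast
  qed
  ultimately show ?thesis
    using assms by (simp add: oriented_chains_def)
qed

lemma chains_finite: "c \<in> oriented_chains K i \<Longrightarrow> finite {xs. c xs \<noteq> 0}"
  by (simp add: oriented_chains_def)

lemma chains_swap:
  assumes "c \<in> oriented_chains K i" "j < k" "k < length xs"
  shows "c (xs[j := xs ! k, k := xs ! j]) = - c xs"
  using assms unfolding oriented_chains_def by blast

lemma boundary_in_chains:
  assumes K: "simplicial_complex K" and c: "c \<in> oriented_chains K (i + 1)"
  shows "boundary c \<in> oriented_chains K i"
proof -
  have head: "\<exists>v. c (v # ys) \<noteq> 0" if "boundary c ys \<noteq> 0" for ys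
    using that unfolding boundary_def by (rule sum.not_neutral_contains_not_neutral) auto
  have "{ys. boundary c ys \<noteq> 0} \<subseteq> tl ` {xs. c xs \<noteq> 0}"
    using head by force
  then have 1: "finite {ys. boundary c ys \<noteq> 0}"
    using chains_finite[OF c] by (meson finite_imageI finite_subset)
  have 2: "distinct ys \<and> set ys \<in> K \<and> int (length ys) = i + 1" if nz: "boundary c ys \<noteq> 0" for ys
  proof -
    obtain v where "c (v # ys) \<noteq> 0" using head[OF nz] by blast
    then have "distinct (v # ys)" "set (v # ys) \<in> K" "int (length (v # ys)) = i + 1 + 1"
      using c unfolding oriented_chains_def by blast+
    then show ?thesis using K unfolding simplicial_complex_def by (auto 4 3)
  qed
  have 3: "boundary c (ys[j := ys ! k, k := ys ! j]) = - boundary c ys"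
    if "j < k" "k < length ys" for ys j k
  proof -
    have sw: "c (v # ys[j := ys ! k, k := ys ! j]) = - c (v # ys)" for v
    proof -
      have "c ((v # ys)[Suc j := (v # ys) ! Suc k, Suc k := (v # ys) ! Suc j]) = - c (v # ys)"
        by (rule chains_swap[OF c]) (use that in simp_all)
      then show ?thesis by simp
    qed
    show ?thesis unfolding boundary_def sw by (simp add: sum_negf)
  qed
  show ?thesis using 1 2 3 by (simp add: oriented_chains_def)
qed

lemma boundary_boundary:
  assumes c: "c \<in> oriented_chains K i"
  shows "boundary (boundary c) = 0"
proof
  fix ys
  define V where "V = (\<Union>xs\<in>{xs. c xs \<noteq> 0}. set xs)"
  have V: "finite V" using chains_finite[OF c] by (simp add: V_def)
  have b: "boundary c zs = (\<Sum>v\<in>V. c (v # zs))" for zs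
    by (rule boundary_superset[OF V]) (force simp: V_def)
  have "v \<in> V" if nz: "boundary c (v # ys) \<noteq> 0" for v
  proof -
    obtain w where "c (w # v # ys) \<noteq> 0" using nz unfolding b
      by (rule sum.not_neutral_contains_not_neutral) auto
    then show ?thesis by (force simp: V_def)
  qed
  then have bb: "boundary (boundary c) ys = (\<Sum>v\<in>V. \<Sum>w\<in>V. c (w # v # ys))"
    by (subst boundary_superset[OF V]) (simp_all add: b)
  have sw: "c (w # v # ys) = - c (v # w # ys)" for v w
  proof -
    have "c ((v # w # ys)[0 := (v # w # ys) ! 1, 1 := (v # w # ys) ! 0]) = - c (v # w # ys)"
      by (rule chains_swap[OF c]) simp_all
    then show ?thesis by simp
  qed
  have "(\<Sum>v\<in>V. \<Sum>w\<in>V. c (w # v # ys)) = (\<Sum>v\<in>V. \<Sum>w\<in>V. - c (v # w # ys))"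
    by (intro sum.cong refl sw)
  also have "\<dots> = - (\<Sum>v\<in>V. \<Sum>w\<in>V. c (w # v # ys))"
    by (subst sum.swap) (simp add: sum_negf)
  finally show "boundary (boundary c) ys = 0 ys" using bb by simp
qed


subsection \<open>The group algebra acting on homology\<close>

lemma algebra_act_lin_ext:
  "algebra_act a c xs = lin_ext a (\<lambda>g. c (map (inv_into UNIV g) xs))"
  by (simp add: algebra_act_def chain_act_def lin_ext_def)

lemma chain_act_in_chains:
  assumes g: "bij g" and K: "\<And>\<sigma>. \<sigma> \<in> K \<Longrightarrow> g ` \<sigma> \<in> K" and c: "c \<in> oriented_chains K i"
  shows "chain_act g c \<in> oriented_chains K i"
proof -
  let ?h = "inv_into UNIV g"
  have inv [simp]: "map g (map ?h xs) = xs" for xs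
    using g by (simp add: bij_is_surj surj_f_inv_f map_idI)
  have "{xs. c (map ?h xs) \<noteq> 0} \<subseteq> map g ` {xs. c xs \<noteq> 0}"
  proof
    fix xs assume "xs \<in> {xs. c (map ?h xs) \<noteq> 0}"
    then show "xs \<in> map g ` {xs. c xs \<noteq> 0}" by (intro image_eqI[of _ _ "map ?h xs"]) (simp_all del: map_map)
  qed
  then have 1: "finite {xs. c (map ?h xs) \<noteq> 0}"
    using chains_finite[OF c] by (meson finite_imageI finite_subset)
  have 2: "distinct xs \<and> set xs \<in> K \<and> int (length xs) = i + 1" if "c (map ?h xs) \<noteq> 0" for xs
  proof -
    have *: "distinct (map ?h xs)" "set (map ?h xs) \<in> K" "int (length (map ?h xs)) = i + 1"
      using c that unfolding oriented_chains_def by blast+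
    have "set xs = g ` set (map ?h xs)" by (metis inv set_map)
    moreover have "distinct xs" using *(1) unfolding distinct_map by simp
    ultimately show ?thesis using K[OF *(2)] *(3) by simp
  qed
  have 3: "c (map ?h (xs[j := xs ! k, k := xs ! j])) = - c (map ?h xs)"
    if "j < k" "k < length xs" for xs j k
  proof -
    have "c ((map ?h xs)[j := map ?h xs ! k, k := map ?h xs ! j]) = - c (map ?h xs)"
      by (rule chains_swap[OF c]) (use that in simp_all)
    then show ?thesis using that by (simp add: map_update)
  qed
  show ?thesis using 1 2 3 by (simp add: oriented_chains_def chain_act_def)
qed

lemma boundary_chain_act:
  assumes g: "bij g" and c: "finite {xs. c xs \<noteq> 0}"
  shows "boundary (chain_act g c) = chain_act g (boundary c)"
proof
  fix ys
  let ?h = "inv_into UNIV g"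
  have h: "bij ?h" using g by (rule bij_imp_bij_inv)
  have "boundary (chain_act g c) ys =
      (\<Sum>v | c (?h v # map ?h ys) \<noteq> 0. c (?h v # map ?h ys))"
    by (simp add: boundary_def chain_act_def)
  also have "\<dots> = (\<Sum>v | c (v # map ?h ys) \<noteq> 0. c (v # map ?h ys))"
    by (rule sum.reindex_bij_witness[of _ g ?h])
       (use g in \<open>auto simp: bij_is_inj bij_is_surj surj_f_inv_f\<close>)
  finally show "boundary (chain_act g c) ys = chain_act g (boundary c) ys"
    by (simp add: boundary_def chain_act_def)
qed

lemma algebra_act_in_chains:
  assumes a: "finite {g. a g \<noteq> 0}" and c: "\<And>g. a g \<noteq> 0 \<Longrightarrow> chain_act g c \<in> oriented_chains K i"
  shows "algebra_act a c \<in> oriented_chains K i"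
proof -
  have nz: "\<exists>g. a g \<noteq> 0 \<and> chain_act g c xs \<noteq> 0" if "algebra_act a c xs \<noteq> 0" for xs
    using that unfolding algebra_act_def
    by (rule sum.not_neutral_contains_not_neutral) auto
  then have "{xs. algebra_act a c xs \<noteq> 0} \<subseteq> (\<Union>g\<in>{g. a g \<noteq> 0}. {xs. chain_act g c xs \<noteq> 0})"
    by auto
  moreover have "finite (\<Union>g\<in>{g. a g \<noteq> 0}. {xs. chain_act g c xs \<noteq> 0})"
    using a c chains_finite by blast
  ultimately have 1: "finite {xs. algebra_act a c xs \<noteq> 0}" by (rule finite_subset)
  have 2: "distinct xs \<and> set xs \<in> K \<and> int (length xs) = i + 1" if "algebra_act a c xs \<noteq> 0" for xs
    using nz[OF that] c unfolding oriented_chains_def by blast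
  have 3: "algebra_act a c (xs[j := xs ! k, k := xs ! j]) = - algebra_act a c xs"
    if "j < k" "k < length xs" for xs j k
  proof -
    have "a g * chain_act g c (xs[j := xs ! k, k := xs ! j]) = - (a g * chain_act g c xs)"
      if "g \<in> {g. a g \<noteq> 0}" for g
      using chains_swap[OF c \<open>j < k\<close> \<open>k < length xs\<close>, of g] that by simp
    then show ?thesis unfolding algebra_act_def by (simp add: sum_negf)
  qed
  show ?thesis using 1 2 3 by (simp add: oriented_chains_def)
qed

lemma boundary_algebra_act:
  assumes a: "finite {g. a g \<noteq> 0}" and bij: "\<And>g. a g \<noteq> 0 \<Longrightarrow> bij g"
    and c: "\<And>g. a g \<noteq> 0 \<Longrightarrow> finite {xs. chain_act g c xs \<noteq> 0}" and c': "finite {xs. c xs \<noteq> 0}"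
  shows "boundary (algebra_act a c) = algebra_act a (boundary c)"
proof
  fix ys
  define V where "V = (\<Union>g\<in>{g. a g \<noteq> 0}. {v. chain_act g c (v # ys) \<noteq> 0})"
  have V: "finite V" using a c finite_heads unfolding V_def by blast
  have "boundary (algebra_act a c) ys = (\<Sum>v\<in>V. algebra_act a c (v # ys))"
  proof (rule boundary_superset[OF V])
    fix v assume "algebra_act a c (v # ys) \<noteq> 0"
    then obtain g where "a g \<noteq> 0" "chain_act g c (v # ys) \<noteq> 0"
      unfolding algebra_act_def
      by (rule sum.not_neutral_contains_not_neutral) auto
    then show "v \<in> V" by (auto simp: V_def)
  qed
  also have "\<dots> = (\<Sum>g | a g \<noteq> 0. \<Sum>v\<in>V. a g * chain_act g c (v # ys))"
    unfolding algebra_act_def by (rule sum.swap)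
  also have "\<dots> = (\<Sum>g | a g \<noteq> 0. a g * boundary (chain_act g c) ys)"
  proof (rule sum.cong[OF refl])
    fix g assume g: "g \<in> {g. a g \<noteq> 0}"
    have "boundary (chain_act g c) ys = (\<Sum>v\<in>V. chain_act g c (v # ys))"
      by (rule boundary_superset[OF V]) (use g in \<open>auto simp: V_def\<close>)
    then show "(\<Sum>v\<in>V. a g * chain_act g c (v # ys)) = a g * boundary (chain_act g c) ys"
      by (simp add: sum_distrib_left)
  qed
  also have "\<dots> = algebra_act a (boundary c) ys"
    unfolding algebra_act_def using boundary_chain_act[OF bij c'] by simp
  finally show "boundary (algebra_act a c) ys = algebra_act a (boundary c) ys" .
qed

theorem left_module_reduced_homology:
  assumes G: "subgroup G \<Gamma>" and \<Gamma>: "group \<Gamma>"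
    and mult: "\<And>g h. g \<otimes>\<^bsub>\<Gamma>\<^esub> h = g \<circ> h" and one: "\<one>\<^bsub>\<Gamma>\<^esub> = id"
    and bij: "\<And>g. g \<in> G \<Longrightarrow> bij g"
    and K: "simplicial_complex K" "\<And>g \<sigma>. g \<in> G \<Longrightarrow> \<sigma> \<in> K \<Longrightarrow> g ` \<sigma> \<in> K"
  shows "left_module (group_algebra (\<Gamma>\<lparr>carrier := G\<rparr>)) (reduced_homology K i)"
proof -
  let ?R = "group_algebra (\<Gamma>\<lparr>carrier := G\<rparr>)"
  have "group (\<Gamma>\<lparr>carrier := G\<rparr>)" using subgroup.subgroup_is_group[OF G \<Gamma>] .
  then have R: "ring ?R" by (intro ring_group_algebra group.is_monoid)
  have fin: "finite {g. a g \<noteq> 0}" and GI: "\<And>g. a g \<noteq> 0 \<Longrightarrow> g \<in> G" if "a \<in> carrier ?R" for a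
    using that by (auto simp: carrier_group_algebra)
  have actc: "chain_act g c \<in> oriented_chains K j" if "g \<in> G" "c \<in> oriented_chains K j" for g c j
    using chain_act_in_chains[OF bij K(2)] that by blast
  have algc: "algebra_act a c \<in> oriented_chains K j" if "a \<in> carrier ?R" "c \<in> oriented_chains K j" for a c j
    using algebra_act_in_chains[OF fin[OF that(1)]] actc GI[OF that(1)] that(2) by blast
  have bd: "boundary (algebra_act a c) = algebra_act a (boundary c)"
    if "a \<in> carrier ?R" "c \<in> oriented_chains K j" for a c j
    using boundary_algebra_act[OF fin[OF that(1)]] bij GI[OF that(1)] actc chains_finite that(2)
    by metis
  have cyc: "cycles K i \<subseteq> oriented_chains K i" by (auto simp: cycles_def)
  show ?thesis
    unfolding reduced_homology_def
  proof (rule left_module_quotient_module[OF R], goal_cases)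
    case 1
    show ?case by (simp add: cycles_def)
  next
    case (2 x y)
    then have "boundary (x - y) = boundary x - boundary y"
      by (intro boundary_diff chains_finite) (auto simp: cycles_def)
    with 2 show ?case by (simp add: cycles_def chains_diff)
  next
    case 3
    show ?case
      unfolding boundaries_def cycles_def
      using boundary_in_chains[OF K(1)] boundary_boundary by blast
  next
    case 4
    show ?case unfolding boundaries_def by (rule image_eqI[of _ _ 0]) simp_all
  next
    case (5 x y)
    then obtain c d where "x = boundary c" "y = boundary d" "c \<in> oriented_chains K (i + 1)" "d \<in> oriented_chains K (i + 1)"
      by (auto simp: boundaries_def)
    moreover from this have "boundary (c - d) = boundary c - boundary d"
      by (intro boundary_diff chains_finite)
    ultimately show ?case
      unfolding boundaries_def by (intro image_eqI[of _ _ "c - d"]) (simp_all add: chains_diff)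
  next
    case (6 a x)
    have "algebra_act a 0 = 0" by (rule ext) (simp add: algebra_act_def chain_act_def)
    with 6 show ?case using algc bd by (fastforce simp: cycles_def)
  next
    case (7 a x)
    then obtain c where "x = boundary c" "c \<in> oriented_chains K (i + 1)" by (auto simp: boundaries_def)
    with 7 show ?case
      unfolding boundaries_def by (intro image_eqI[of _ _ "algebra_act a c"]) (simp_all add: algc bd)
  next
    case (8 a x y)
    show ?case
      by (rule ext) (simp add: algebra_act_def chain_act_def algebra_simps sum_subtractf)
  next
    case (9 a b x)
    have "a \<oplus>\<^bsub>?R\<^esub> b = a + b" by (simp add: group_algebra_def)
    with 9 show ?case by (intro ext) (simp add: algebra_act_lin_ext lin_ext_add_left fin)
  next
    case (10 a b x)
    show ?case
    proof
      fix xs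
      have "algebra_act (a \<otimes>\<^bsub>?R\<^esub> b) x xs =
          lin_ext a (\<lambda>g. lin_ext b (\<lambda>h. x (map (inv_into UNIV (g \<circ> h)) xs)))"
        using 10 by (simp add: algebra_act_lin_ext lin_ext_mult fin mult)
      also have "\<dots> = lin_ext a (\<lambda>g. lin_ext b (\<lambda>h. x (map (inv_into UNIV h) (map (inv_into UNIV g) xs))))"
        using 10 GI bij by (intro lin_ext_cong) (simp add: o_inv_distrib)
      also have "\<dots> = algebra_act a (algebra_act b x) xs"
        by (simp add: algebra_act_lin_ext del: map_map)
      finally show "algebra_act (a \<otimes>\<^bsub>?R\<^esub> b) x xs = algebra_act a (algebra_act b x) xs" .
    qed
  next
    case (11 x)
    show ?case
      by (rule ext) (simp add: algebra_act_lin_ext group_algebra_def one lin_ext_one)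
  qed
qed


subsection \<open>Oriented simplices\<close>

lemma permute_list_transpose:
  assumes "j < length xs" "k < length xs"
  shows "permute_list (transpose j k) xs = xs[j := xs ! k, k := xs ! j]"
  using assms by (auto intro!: nth_equalityI simp: permute_list_def nth_list_update transpose_def)

lemma chains_permute:
  assumes c: "c \<in> oriented_chains K i" and p: "p permutes {..<length ys}"
  shows "c (permute_list p ys) = of_int (sign p) * c ys"
proof -
  have "\<forall>ys. length ys = n \<longrightarrow> c (permute_list p ys) = of_int (sign p) * c ys"
    if "p permutes {..<n}" for p and n :: nat
    using that finite_lessThan
  proof (induction p rule: permutes_induct)
    case (swap a b p)
    show ?case
    proof (intro allI impI)
      fix ys :: "'a list" assume n: "length ys = n"
      have t: "c (permute_list (transpose a b) ys) = of_int (sign (transpose a b)) * c ys"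
      proof (cases a b rule: linorder_cases)
        case less
        then show ?thesis
          using swap n chains_swap[OF c less] by (simp add: permute_list_transpose sign_swap_id)
      next
        case greater
        then have "c (permute_list (transpose b a) ys) = - c ys"
          using swap n chains_swap[OF c greater] by (simp add: permute_list_transpose)
        then show ?thesis using greater by (simp add: sign_swap_id transpose_commute)
      qed simp
      have perm: "permutation p" "permutation (transpose a b)"
        using swap permutation_swap_id by (auto simp: permutation_permutes)
      have "c (permute_list (transpose a b \<circ> p) ys) =
          c (permute_list p (permute_list (transpose a b) ys))"
        using swap n by (simp add: permute_list_compose)
      also have "\<dots> = of_int (sign p) * c (permute_list (transpose a b) ys)"
        using swap n by simp
      finally show "c (permute_list (transpose a b \<circ> p) ys) =
          of_int (sign (transpose a b \<circ> p)) * c ys"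
        using t perm by (simp add: sign_compose)
    qed
  qed simp_all
  with p show ?thesis by blast
qed

lemma oriented_simplex_self:
  assumes "distinct xs"
  shows "oriented_simplex xs xs = 1"
proof -
  have "{p. p permutes {..<length xs} \<and> permute_list p xs = xs} = {id}"
  proof (intro equalityI subsetI)
    fix p assume "p \<in> {p. p permutes {..<length xs} \<and> permute_list p xs = xs}"
    then have p: "p permutes {..<length xs}" "permute_list p xs = xs" by auto
    have "p j = j" for j
    proof (cases "j < length xs")
      case True
      then have "xs ! p j = xs ! j" "p j < length xs"
        using p permute_list_nth[OF p(1) True] permutes_in_image[OF p(1)] by auto
      with True assms show ?thesis by (simp add: nth_eq_iff_index_eq)
    next
      case False
      then show ?thesis using p(1) by (simp add: permutes_def)
    qed
    then show "p \<in> {id}" by auto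
  qed (auto simp: permutes_id)
  then show ?thesis by (simp add: oriented_simplex_def)
qed

lemma oriented_simplex_nonzero:
  assumes "oriented_simplex xs ys \<noteq> 0"
  obtains p where "p permutes {..<length xs}" "permute_list p xs = ys"
proof -
  from assms have "(\<Sum>p | p permutes {..<length xs} \<and> permute_list p xs = ys.
      of_int (sign p) :: complex) \<noteq> 0"
    unfolding oriented_simplex_def .
  then obtain p where "p \<in> {p. p permutes {..<length xs} \<and> permute_list p xs = ys}"
    by (rule sum.not_neutral_contains_not_neutral)
  then show thesis using that by blast
qed

lemma oriented_simplex_mset: "oriented_simplex xs ys \<noteq> 0 \<Longrightarrow> mset ys = mset xs"
  by (erule oriented_simplex_nonzero) (metis mset_permute_list)

lemma oriented_simplex_in_chains:
  assumes "distinct xs" "set xs \<in> K"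
  shows "oriented_simplex xs \<in> oriented_chains K (int (length xs) - 1)"
proof -
  have "{ys. oriented_simplex xs ys \<noteq> 0} \<subseteq> (\<lambda>p. permute_list p xs) ` {p. p permutes {..<length xs}}"
    by (auto elim: oriented_simplex_nonzero)
  then have 1: "finite {ys. oriented_simplex xs ys \<noteq> 0}"
    by (rule finite_subset) (intro finite_imageI finite_permutations finite_lessThan)
  have 2: "distinct ys \<and> set ys \<in> K \<and> int (length ys) = int (length xs) - 1 + 1"
    if "oriented_simplex xs ys \<noteq> 0" for ys
    using oriented_simplex_nonzero[OF that] assms by (metis diff_add_cancel distinct_permute_list
        length_permute_list set_permute_list)
  have 3: "oriented_simplex xs (ys[j := ys ! k, k := ys ! j]) = - oriented_simplex xs ys"
    if jk: "j < k" "k < length ys" for ys j k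
  proof (cases "length ys = length xs")
    case True
    let ?t = "transpose j k"
    have t: "?t permutes {..<length xs}" using jk True by (intro permutes_swap_id) auto
    have tt: "?t \<circ> ?t = id" by simp
    have pl: "permute_list (p \<circ> ?t) xs = permute_list ?t (permute_list p xs)" for p
      using t by (rule permute_list_compose)
    have invol: "permute_list ?t (permute_list ?t zs) = zs" if "length zs = length xs" for zs :: "'a list"
      using permute_list_compose[of ?t zs ?t] t that tt by simp
    have "oriented_simplex xs (permute_list ?t ys) =
        (\<Sum>p | p permutes {..<length xs} \<and> permute_list p xs = ys. of_int (sign (p \<circ> ?t)))"
      unfolding oriented_simplex_def
    proof (rule sum.reindex_bij_witness[of _ "\<lambda>p. p \<circ> ?t" "\<lambda>p. p \<circ> ?t"], goal_cases)
      case (1 p)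
      then show ?case using tt by (simp add: comp_assoc)
    next
      case (2 p)
      then show ?case using t pl invol True by (auto intro: permutes_compose)
    next
      case (3 p)
      then show ?case using tt by (simp add: comp_assoc)
    next
      case (4 p)
      then show ?case using t pl by (auto intro: permutes_compose)
    next
      case (5 p)
      then show ?case using tt by (simp add: comp_assoc)
    qed
    also have "\<dots> = - oriented_simplex xs ys"
    proof -
      have "sign (p \<circ> ?t) = - sign p" if "p permutes {..<length xs}" for p
      proof -
        have "permutation p" using that by (auto simp: permutation_permutes)
        then show ?thesis
          using jk by (simp add: sign_compose permutation_swap_id sign_swap_id)
      qed
      then show ?thesis by (simp add: oriented_simplex_def sum_negf)
    qed
    finally show ?thesis using jk by (simp add: permute_list_transpose)
  next
    case False
    then have "oriented_simplex xs zs = 0" if "length zs = length ys" for zs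
      using that oriented_simplex_mset[of xs zs] by (metis size_mset)
    then show ?thesis by simp
  qed
  show ?thesis using 1 2 3 by (simp add: oriented_chains_def)
qed

lemma chain_act_oriented_simplex:
  assumes "bij g"
  shows "chain_act g (oriented_simplex xs) = oriented_simplex (map g xs)"
proof
  fix ys
  have "permute_list p (map g xs) = ys \<longleftrightarrow> permute_list p xs = map (inv_into UNIV g) ys"
    if p: "p permutes {..<length xs}" for p
  proof -
    have "map g (map (inv_into UNIV g) ys) = ys" "map (inv_into UNIV g) (map g zs) = zs" for zs
      using assms by (simp_all add: bij_is_surj surj_f_inv_f bij_is_inj map_idI)
    then show ?thesis using permute_list_map[OF p] by metis
  qed
  then show "chain_act g (oriented_simplex xs) ys = oriented_simplex (map g xs) ys"
    unfolding chain_act_def oriented_simplex_def by (intro sum.cong) auto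
qed

lemma chains_move_front:
  assumes c: "c \<in> oriented_chains K i"
  shows "c (us @ v # vs @ ws) = (- 1) ^ length vs * c (us @ vs @ v # ws)"
proof (induction vs arbitrary: us)
  case (Cons a vs)
  let ?xs = "us @ a # v # vs @ ws"
  have "c (?xs[length us := ?xs ! Suc (length us), Suc (length us) := ?xs ! length us]) = - c ?xs"
    by (rule chains_swap[OF c]) simp_all
  then have "c (us @ v # a # vs @ ws) = - c ?xs"
    by (simp add: nth_append list_update_append)
  with Cons[of "us @ [a]"] show ?case by simp
qed simp

theorem boundary_oriented_simplex:
  assumes xs: "distinct xs"
  shows "boundary (oriented_simplex xs) =
    (\<lambda>ys. \<Sum>j<length xs. (- 1) ^ j * oriented_simplex (take j xs @ drop (Suc j) xs) ys)"
proof
  fix ys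
  define K where "K = Pow (set xs)"
  define n where "n = length xs"
  define d where "d j = take j xs @ drop (Suc j) xs" for j
  have K: "simplicial_complex K"
    by (auto simp: K_def simplicial_complex_def dest: finite_subset[OF _ finite_set])
  have os: "oriented_simplex xs \<in> oriented_chains K (int n - 1)"
    unfolding n_def using xs by (intro oriented_simplex_in_chains) (auto simp: K_def)
  have bd: "boundary (oriented_simplex xs) \<in> oriented_chains K (int n - 2)"
  proof (rule boundary_in_chains[OF K])
    have "int n - 2 + 1 = int n - 1" by simp
    with os show "oriented_simplex xs \<in> oriented_chains K (int n - 2 + 1)" by (simp only:)
  qed
  have xsj: "xs = take j xs @ xs ! j # drop (Suc j) xs" if "j < n" for j
    using that unfolding n_def by (rule id_take_nth_drop)
  have mset_xs: "mset xs = add_mset (xs ! j) (mset (d j))" if "j < n" for j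
    by (subst xsj[OF that]) (simp add: d_def)
  have dist: "distinct (d j)" if "j < n" for j
    using xs unfolding d_def by (subst (asm) xsj[OF that]) auto
  have len: "length (d j) = n - 1" if "j < n" for j
    using that by (simp add: d_def n_def)
  have osd: "oriented_simplex (d j) \<in> oriented_chains K (int n - 2)" if "j < n" for j
  proof -
    have "oriented_simplex (d j) \<in> oriented_chains K (int (length (d j)) - 1)"
      using dist[OF that] set_take_subset[of j xs] set_drop_subset[of "Suc j" xs]
      by (intro oriented_simplex_in_chains) (auto simp: K_def d_def)
    then show ?thesis using len[OF that] that by (simp add: of_nat_diff)
  qed
  let ?L = "boundary (oriented_simplex xs)"
  let ?R = "\<lambda>ys. \<Sum>j<n. (- 1) ^ j * oriented_simplex (d j) ys"
  have face: "?L (d j) = ?R (d j)" if j: "j < n" for j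
  proof -
    have "?L (d j) = (\<Sum>v\<in>{xs ! j}. oriented_simplex xs (v # d j))"
    proof (rule boundary_superset)
      fix v assume "oriented_simplex xs (v # d j) \<noteq> 0"
      then show "v \<in> {xs ! j}"
        using oriented_simplex_mset[of xs "v # d j"] mset_xs[OF j] by simp
    qed simp
    also have "\<dots> = (- 1) ^ j"
    proof -
      have "oriented_simplex xs ([] @ xs ! j # take j xs @ drop (Suc j) xs) = (- 1) ^ j *
          oriented_simplex xs ([] @ take j xs @ xs ! j # drop (Suc j) xs)"
        using chains_move_front[OF os, of "[]" "xs ! j" "take j xs"] j by (simp add: n_def)
      then show ?thesis
        using xsj[OF j] oriented_simplex_self[OF xs] by (simp add: d_def)
    qed
    also have "\<dots> = (\<Sum>k<n. if k = j then (- 1) ^ k else 0)" using j by simp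
    also have "\<dots> = ?R (d j)"
    proof (rule sum.cong[OF refl])
      fix k assume k: "k \<in> {..<n}"
      show "(if k = j then (- 1) ^ k else 0) = (- 1) ^ k * oriented_simplex (d k) (d j)"
      proof (cases "k = j")
        case True
        then show ?thesis using oriented_simplex_self[OF dist[OF j]] by simp
      next
        case False
        then have "xs ! k \<noteq> xs ! j" using xs j k by (simp add: nth_eq_iff_index_eq n_def)
        then have "mset (d j) \<noteq> mset (d k)"
          using mset_xs[OF j] mset_xs[of k] k by auto
        then have "oriented_simplex (d k) (d j) = 0" using oriented_simplex_mset by metis
        with False show ?thesis by simp
      qed
    qed
    finally show ?thesis .
  qed
  have perm: "?L (permute_list p (d j)) = ?R (permute_list p (d j))"
    if j: "j < n" and p: "p permutes {..<length (d j)}" for p j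
  proof -
    have "?R (permute_list p (d j)) = (\<Sum>k<n. of_int (sign p) * ((- 1) ^ k * oriented_simplex (d k) (d j)))"
      using chains_permute[OF osd p] by (intro sum.cong) simp_all
    also have "\<dots> = of_int (sign p) * ?R (d j)" by (simp add: sum_distrib_left)
    finally show ?thesis using chains_permute[OF bd p] face[OF j] by simp
  qed
  have "?L ys = ?R ys"
  proof (cases "\<exists>j<n. mset ys = mset (d j)")
    case True
    then obtain j where j: "j < n" "mset ys = mset (d j)" by blast
    then obtain p where "p permutes {..<length (d j)}" "permute_list p (d j) = ys"
      using mset_eq_permutation by metis
    then show ?thesis using perm[OF j(1)] by metis
  next
    case False
    have "oriented_simplex xs (v # ys) = 0" for v
    proof (rule ccontr)
      assume "oriented_simplex xs (v # ys) \<noteq> 0"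
      then have m: "add_mset v (mset ys) = mset xs" using oriented_simplex_mset by fastforce
      then have "v \<in> set xs" by (metis set_mset_mset union_single_eq_member)
      then obtain j where "j < n" "xs ! j = v" by (auto simp: in_set_conv_nth n_def)
      with m mset_xs[of j] have "mset ys = mset (d j)" by simp
      with False \<open>j < n\<close> show False by blast
    qed
    then have "?L ys = 0" by (simp add: boundary_def)
    moreover have "?R ys = 0"
      using False oriented_simplex_mset by (intro sum.neutral) fastforce
    ultimately show ?thesis by simp
  qed
  then show "?L ys = (\<Sum>j<length xs. (- 1) ^ j * oriented_simplex (take j xs @ drop (Suc j) xs) ys)"
    by (simp add: n_def d_def)
qed


subsection \<open>The complexes of a lattice\<close>

lemma group_lattice_Aut: "group (lattice_Aut :: ('a::lattice \<Rightarrow> 'a) monoid)"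
proof (rule groupI, goal_cases)
  case (1 g h)
  then show ?case by (simp add: lattice_Aut_def bij_comp)
next
  case (5 g)
  then have g: "bij g" "\<And>x y. g (inf x y) = inf (g x) (g y)" "\<And>x y. g (sup x y) = sup (g x) (g y)"
    by (auto simp: lattice_Aut_def)
  let ?h = "inv_into UNIV g"
  have gh: "g (?h x) = x" and hg: "?h (g x) = x" for x
    using g(1) by (simp_all add: bij_is_surj surj_f_inv_f bij_is_inj)
  have "?h (inf x y) = inf (?h x) (?h y)" "?h (sup x y) = sup (?h x) (?h y)" for x y
    by (metis gh hg g(2)) (metis gh hg g(3))
  then have "?h \<in> carrier lattice_Aut"
    using g(1) by (simp add: lattice_Aut_def bij_imp_bij_inv)
  then show ?case using hg by (intro bexI[of _ ?h]) (auto simp: lattice_Aut_def)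
qed (auto simp: lattice_Aut_def comp_assoc)

lemma simplicial_complex_order_complex:
  "simplicial_complex (order_complex :: 'a::bounded_lattice set set)"
proof -
  have "\<tau> \<in> order_complex" if "\<sigma> \<in> order_complex" "\<tau> \<subseteq> \<sigma>" for \<sigma> \<tau> :: "'a set"
    using that finite_subset[OF that(2)] unfolding order_complex_def chain_def by blast
  moreover have "{} \<in> (order_complex :: 'a set set)"
    by (simp add: order_complex_def chain_def)
  moreover have "finite \<sigma>" if "\<sigma> \<in> order_complex" for \<sigma> :: "'a set"
    using that by (simp add: order_complex_def)
  ultimately show ?thesis
    unfolding simplicial_complex_def by blast
qed

lemma simplicial_complex_crosscut_complex:
  "simplicial_complex (crosscut_complex (C :: 'a::bounded_lattice set))"
proof -
  have "spans S" if "finite S" "T \<subseteq> S" "spans T" for S T :: "'a set"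
  proof -
    have ne: "T \<noteq> {}" "S \<noteq> {}" using that(2,3) unfolding spans_def by blast+
    have "Inf_fin S \<le> Inf_fin T" "Sup_fin T \<le> Sup_fin S"
      using that ne by (simp_all add: Inf_fin.subset_imp Sup_fin.subset_imp)
    then show ?thesis using that ne by (simp add: spans_def bot_unique top_unique)
  qed
  then have "T \<in> crosscut_complex C" if "S \<in> crosscut_complex C" "T \<subseteq> S" for S T
    using that finite_subset[OF that(2)] unfolding crosscut_complex_def by blast
  moreover have "{} \<in> crosscut_complex C"
    by (simp add: crosscut_complex_def spans_def)
  moreover have "finite S" if "S \<in> crosscut_complex C" for S
    using that by (simp add: crosscut_complex_def)
  ultimately show ?thesis
    unfolding simplicial_complex_def by blast
qed

lemma lattice_AutD:
  assumes "g \<in> carrier lattice_Aut"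
  shows "bij g" "g (inf x y) = inf (g x) (g y)" "g (sup x y) = sup (g x) (g y)"
  using assms unfolding lattice_Aut_def by simp_all

lemma lattice_Aut_bot_top:
  assumes "g \<in> carrier (lattice_Aut :: ('a::bounded_lattice \<Rightarrow> 'a) monoid)"
  shows "g Orderings.bot = Orderings.bot" "g Orderings.top = Orderings.top"
proof -
  have "surj g" using lattice_AutD(1)[OF assms] by (rule bij_is_surj)
  then obtain b t where bt: "g b = Orderings.bot" "g t = Orderings.top" unfolding surj_def by metis
  show "g Orderings.bot = Orderings.bot"
    using lattice_AutD(2)[OF assms, of b Orderings.bot] bt by simp
  show "g Orderings.top = Orderings.top"
    using lattice_AutD(3)[OF assms, of t Orderings.top] bt by simp
qed

lemma lattice_Aut_le:
  assumes "g \<in> carrier lattice_Aut"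
  shows "g x \<le> g y \<longleftrightarrow> x \<le> y"
proof -
  have "inj g" using lattice_AutD(1)[OF assms] by (rule bij_is_inj)
  then show ?thesis
    using lattice_AutD(2)[OF assms, of x y] unfolding inf.absorb_iff1 by (metis injD)
qed

lemma image_order_complex:
  assumes g: "g \<in> carrier lattice_Aut" and \<sigma>: "\<sigma> \<in> order_complex"
  shows "g ` \<sigma> \<in> order_complex"
proof -
  have inj: "inj g" using lattice_AutD(1)[OF g] by (rule bij_is_inj)
  have "Orderings.bot \<notin> \<sigma>" "Orderings.top \<notin> \<sigma>" using \<sigma> by (simp_all add: order_complex_def)
  then have "Orderings.bot \<notin> g ` \<sigma>" "Orderings.top \<notin> g ` \<sigma>"
    using inj_image_mem_iff[OF inj] lattice_Aut_bot_top[OF g] by metis+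
  then show ?thesis
    using \<sigma> lattice_Aut_le[OF g] by (auto simp: order_complex_def chain_def)
qed

lemma image_crosscut_complex:
  assumes g: "g \<in> carrier lattice_Aut" and C: "g ` C = C" and S: "S \<in> crosscut_complex C"
  shows "g ` S \<in> crosscut_complex C"
proof -
  have inj: "inj g" using lattice_AutD(1)[OF g] by (rule bij_is_inj)
  have S': "finite S" "S \<subseteq> C" "\<not> spans S" using S by (simp_all add: crosscut_complex_def)
  have "\<not> spans (g ` S)"
  proof
    assume sp: "spans (g ` S)"
    then have ne: "S \<noteq> {}" by (simp add: spans_def)
    then have "g (Inf_fin S) = Inf_fin (g ` S)" "g (Sup_fin S) = Sup_fin (g ` S)"
      using S'(1) by (simp_all add: Inf_fin.hom_commute Sup_fin.hom_commute lattice_AutD(2,3)[OF g])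
    with sp have "g (Inf_fin S) = g Orderings.bot" "g (Sup_fin S) = g Orderings.top"
      by (simp_all add: spans_def lattice_Aut_bot_top[OF g])
    with ne S'(3) show False by (simp add: spans_def inj_eq[OF inj])
  qed
  then show ?thesis using S' C by (simp add: crosscut_complex_def) blast
qed

theorem left_module_reduced_homology_lattice:
  fixes G :: "('a::bounded_lattice \<Rightarrow> 'a) set"
  assumes G: "subgroup G lattice_Aut"
  shows "left_module (group_algebra (lattice_Aut\<lparr>carrier := G\<rparr>))
      (reduced_homology (order_complex :: 'a set set) i)"
    and "\<forall>g\<in>G. g ` C = C \<Longrightarrow> left_module (group_algebra (lattice_Aut\<lparr>carrier := G\<rparr>))
      (reduced_homology (crosscut_complex C) i)"
proof -
  have car: "g \<in> carrier lattice_Aut" if "g \<in> G" for g using subgroup.subset[OF G] that by blast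
  have bij: "bij g" if "g \<in> G" for g using car[OF that] by (rule lattice_AutD(1))
  have ops: "g \<otimes>\<^bsub>lattice_Aut\<^esub> h = g \<circ> h" "\<one>\<^bsub>lattice_Aut\<^esub> = id" for g h :: "'a \<Rightarrow> 'a"
    by (simp_all add: lattice_Aut_def)
  note module = left_module_reduced_homology[OF G group_lattice_Aut ops bij]
  show "left_module (group_algebra (lattice_Aut\<lparr>carrier := G\<rparr>))
      (reduced_homology (order_complex :: 'a set set) i)"
    by (rule module) (simp_all add: car image_order_complex simplicial_complex_order_complex)
  show "left_module (group_algebra (lattice_Aut\<lparr>carrier := G\<rparr>))
      (reduced_homology (crosscut_complex C) i)" if "\<forall>g\<in>G. g ` C = C"
    by (rule module)
       (use that in \<open>simp_all add: car image_crosscut_complex simplicial_complex_crosscut_complex\<close>)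
qed

end

theory Submission
  imports Defs
begin

text \<open>
  The order complex \<open>K(L)\<close> and the cross-cut complex \<open>K(C)\<close> are compared inside a third
  \<open>G\<close>-stable complex \<open>J\<close>, the \<open>joint_complex\<close>: its simplices are the unions of a
  chain \<open>\<sigma>\<close> of \<open>L - {0, 1}\<close> and a simplex \<open>S\<close> of \<open>K(C)\<close> such that every element of \<open>\<sigma>\<close> is
  comparable to every element of \<open>S\<close>.  Both \<open>K(L)\<close> and \<open>K(C)\<close> are subcomplexes of \<open>J\<close>, and both
  inclusions induce isomorphisms in reduced homology.  They commute with the action of \<open>G\<close>, so
  the isomorphism \<open>H(K(L)) \<simeq> H(J) \<simeq> H(K(C))\<close> is one of modules over the group algebra, although
  the constructions which prove bijectivity depend on choices that no group element respects.

  A simplex of \<open>J\<close> fails to lie in \<open>K(L)\<close> when it contains a set \<open>S\<close> of at least two elements of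
  \<open>C\<close>, and it fails to lie in \<open>K(C)\<close> when it contains a nonempty chain \<open>\<sigma>\<close> outside \<open>C\<close>.  In both
  cases the remaining vertices can be completed by an apex that depends only on \<open>S\<close> or \<open>\<sigma>\<close>:
    \<^item> every element outside \<open>C\<close> comparable to all of \<open>S\<close> lies below all of \<open>S\<close> or above all of \<open>S\<close>,
      because \<open>C\<close> is an antichain; hence the meet of \<open>S\<close>, or the join when the meet is \<open>0\<close>, is
      comparable to all these elements (\<open>insert_meet_or_join\<close>);
    \<^item> the chain \<open>\<sigma>\<close> extends to a chain which meets \<open>C\<close>, so some \<open>c \<in> C\<close> is comparable to all of
      \<open>\<sigma>\<close>; and a finite set of elements of \<open>C\<close> comparable to an element of \<open>\<sigma>\<close> does not span
      (\<open>insert_comparable_cut_element\<close>).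

  The topological input is that such apexes make the homology of \<open>J\<close> relative to the subcomplex
  vanish (\<open>relative_cycle_homologous_to_subcomplex\<close>).  Filter \<open>J\<close> by the number of vertices in the
  part \<open>S\<close> (or \<open>\<sigma>\<close>) of a simplex.  On a graded piece the boundary only removes vertices from the other
  part, and the graded piece is a sum of augmented chain complexes of cones; so the top graded part
  of a relative cycle is removed by subtracting the boundary of its cone (\<open>cone_step\<close>).
\<close>


section \<open>Oriented chains as combinations of oriented simplices\<close>

lemma chains_add:
  assumes "c \<in> oriented_chains K i" "d \<in> oriented_chains K i"
  shows "c + d \<in> oriented_chains K i"
  using chains_diff[OF assms(1) chains_diff[OF chains_zero assms(2)]] by simp

lemma chains_scale:
  assumes "c \<in> oriented_chains K i"
  shows "(\<lambda>xs. r * c xs) \<in> oriented_chains K i"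
proof -
  have "{xs. r * c xs \<noteq> 0} \<subseteq> {xs. c xs \<noteq> 0}" by auto
  then have "finite {xs. r * c xs \<noteq> 0}"
    using chains_finite[OF assms] by (rule finite_subset)
  then show ?thesis
    using assms by (simp add: oriented_chains_def)
qed

lemma chains_subcomplex:
  assumes "c \<in> oriented_chains J i" "\<And>xs. c xs \<noteq> 0 \<Longrightarrow> set xs \<in> K"
  shows "c \<in> oriented_chains K i"
  using assms by (simp add: oriented_chains_def)

lemma chains_mono: "J \<subseteq> K \<Longrightarrow> oriented_chains J i \<subseteq> oriented_chains K i"
  unfolding oriented_chains_def by blast

lemma chainsD:
  assumes "c \<in> oriented_chains K i" "c xs \<noteq> 0"
  shows "distinct xs" "set xs \<in> K" "int (length xs) = i + 1"
  using assms unfolding oriented_chains_def by blast+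

lemma oriented_simplex_permute:
  assumes "distinct xs" "p permutes {..<length xs}"
  shows "oriented_simplex xs (permute_list p xs) = of_int (sign p)"
proof -
  have "oriented_simplex xs \<in> oriented_chains {set xs} (int (length xs) - 1)"
    using assms(1) by (rule oriented_simplex_in_chains) simp
  from chains_permute[OF this assms(2)] show ?thesis
    using oriented_simplex_self[OF assms(1)] by simp
qed

text \<open>Every oriented chain is a finite combination of oriented simplices.  Subtracting the
  simplex on one ordering \<open>xs\<close> with coefficient \<open>c xs\<close> clears all orderings of the same vertex set
  at once, since both sides change by the sign of the permutation.\<close>

lemma chain_induct [consumes 1, case_names zero simplex add]:
  assumes "c \<in> oriented_chains K i"
    and zero: "P 0"
    and simplex: "\<And>xs r. distinct xs \<Longrightarrow> set xs \<in> K \<Longrightarrow> int (length xs) = i + 1 \<Longrightarrow>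
      P (\<lambda>ys. r * oriented_simplex xs ys)"
    and add: "\<And>c d. P c \<Longrightarrow> P d \<Longrightarrow> P (c + d)"
  shows "P c"
  using assms(1)
proof (induction "card {xs. c xs \<noteq> 0}" arbitrary: c rule: less_induct)
  case less
  show ?case
  proof (cases "c = 0")
    case True
    then show ?thesis using zero by simp
  next
    case False
    then obtain xs where xs: "c xs \<noteq> 0" by (auto simp: fun_eq_iff)
    note D = chainsD[OF less.prems xs]
    define s where "s = (\<lambda>ys. c xs * oriented_simplex xs ys)"
    have os: "oriented_simplex xs \<in> oriented_chains K i"
      using oriented_simplex_in_chains[OF D(1,2)] D(3) by simp
    have s: "s \<in> oriented_chains K i" unfolding s_def using os by (rule chains_scale)
    have eq: "(c - s) ys = 0" if "c ys = 0 \<or> ys = xs" for ys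
    proof (cases "oriented_simplex xs ys = 0")
      case True
      then show ?thesis using that oriented_simplex_self[OF D(1)] by (auto simp: s_def)
    next
      case False
      then obtain p where p: "p permutes {..<length xs}" "permute_list p xs = ys"
        by (rule oriented_simplex_nonzero)
      then show ?thesis
        using chains_permute[OF less.prems p(1)] oriented_simplex_permute[OF D(1) p(1)]
        by (simp add: s_def)
    qed
    have "{ys. (c - s) ys \<noteq> 0} \<subset> {ys. c ys \<noteq> 0}"
      using eq xs by blast
    then have "card {ys. (c - s) ys \<noteq> 0} < card {ys. c ys \<noteq> 0}"
      using chains_finite[OF less.prems] by (rule psubset_card_mono[rotated])
    then have "P (c - s)" using less.hyps chains_diff[OF less.prems s] by blast
    moreover have "P s" unfolding s_def using simplex[OF D] .
    ultimately have "P (c - s + s)" by (rule add)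
    then show ?thesis by simp
  qed
qed

lemma oriented_simplex_set: "oriented_simplex xs ys \<noteq> 0 \<Longrightarrow> set ys = set xs"
  by (rule mset_eq_setD[OF oriented_simplex_mset])

text \<open>As functions of \<open>ys\<close> both sides are alternating, vanish unless \<open>ys\<close> is an ordering of
  \<open>xs\<close>, and take the value \<open>1\<close> at \<open>xs\<close>.\<close>

lemma oriented_simplex_Cons:
  assumes "distinct (v # xs)"
  shows "oriented_simplex (v # xs) (v # ys) = oriented_simplex xs ys"
proof -
  define d where "d = (\<lambda>ys. oriented_simplex (v # xs) (v # ys))"
  have os: "oriented_simplex (v # xs) \<in> oriented_chains {set (v # xs)} (int (length (v # xs)) - 1)"
    using assms by (rule oriented_simplex_in_chains) simp
  have "finite {ys. d ys \<noteq> 0}"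
  proof -
    have "(#) v ` {ys. d ys \<noteq> 0} \<subseteq> {ys. oriented_simplex (v # xs) ys \<noteq> 0}"
      by (auto simp: d_def)
    then show ?thesis
      using chains_finite[OF os] by (meson finite_imageD finite_subset inj_onI list.inject)
  qed
  moreover have "distinct ys \<and> set ys \<in> UNIV \<and> int (length ys) = int (length xs) - 1 + 1" if "d ys \<noteq> 0" for ys
    using chainsD[OF os] that unfolding d_def by fastforce
  moreover have "d (ys[j := ys ! k, k := ys ! j]) = - d ys" if "j < k" "k < length ys" for ys j k
    using chains_swap[OF os, of "Suc j" "Suc k" "v # ys"] that by (simp add: d_def)
  ultimately have d: "d \<in> oriented_chains UNIV (int (length xs) - 1)"
    by (simp add: oriented_chains_def)
  have "d ys = oriented_simplex xs ys"
  proof (cases "mset ys = mset xs")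
    case True
    then obtain p where p: "p permutes {..<length xs}" "permute_list p xs = ys"
      using mset_eq_permutation by metis
    have "d xs = 1" unfolding d_def by (rule oriented_simplex_self[OF assms])
    then show ?thesis
      using chains_permute[OF d p(1)] oriented_simplex_permute[of xs p] p assms by simp
  next
    case False
    then show ?thesis
      using oriented_simplex_mset[of xs ys] oriented_simplex_mset[of "v # xs" "v # ys"]
      by (cases "d ys = 0"; cases "oriented_simplex xs ys = 0") (simp_all add: d_def)
  qed
  then show ?thesis by (simp add: d_def)
qed


section \<open>Subcomplexes with vanishing relative homology\<close>

text \<open>
  In this section \<open>B\<close> is a set of vertices of \<open>J\<close>, and the subcomplex consists of the simplices with
  fewer than \<open>k\<close> vertices in \<open>B\<close>.  For every other simplex \<open>\<tau>\<close> there is an apex \<open>a (\<tau> \<inter> B)\<close> outside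
  \<open>B\<close> that can be added to \<open>\<tau>\<close>.  The apex depends on the part of \<open>\<tau>\<close> in \<open>B\<close> only, so adding it does
  not change the apex.
\<close>

text \<open>The chain \<open>w\<close> is the linear extension of \<open>[x\<^sub>0, \<dots>, x\<^sub>i] \<mapsto> [a, x\<^sub>0, \<dots>, x\<^sub>i]\<close>, where \<open>a\<close> is the
  apex of the simplex; degenerate cones, and cones over simplices of the subcomplex, are \<open>0\<close>.  Its
  values at lists headed by their apex, together with the vanishing at lists not
  containing it, are all that boundary computations need.\<close>

lemma cone_chain_exists:
  assumes apex: "\<And>\<tau>. \<tau> \<in> J \<Longrightarrow> k \<le> card (\<tau> \<inter> B) \<Longrightarrow> a (\<tau> \<inter> B) \<notin> B \<and> insert (a (\<tau> \<inter> B)) \<tau> \<in> J"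
    and z: "z \<in> oriented_chains J i"
  obtains w where "w \<in> oriented_chains J (i + 1)"
    and "\<And>xs. k \<le> card (set xs \<inter> B) \<Longrightarrow> a (set xs \<inter> B) \<notin> set xs \<Longrightarrow> a (set xs \<inter> B) \<notin> B \<Longrightarrow>
      w (a (set xs \<inter> B) # xs) = z xs"
    and "\<And>ys. w ys \<noteq> 0 \<Longrightarrow> k \<le> card (set ys \<inter> B) \<and> a (set ys \<inter> B) \<in> set ys"
proof -
  let ?a = "\<lambda>xs. a (set xs \<inter> B)"
  let ?P = "\<lambda>z. \<exists>w\<in>oriented_chains J (i + 1).
    (\<forall>xs. k \<le> card (set xs \<inter> B) \<longrightarrow> ?a xs \<notin> set xs \<longrightarrow> ?a xs \<notin> B \<longrightarrow> w (?a xs # xs) = z xs) \<and>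
    (\<forall>ys. w ys \<noteq> 0 \<longrightarrow> k \<le> card (set ys \<inter> B) \<and> ?a ys \<in> set ys)"
  have "?P z" using z
  proof (induction rule: chain_induct)
    case zero
    show ?case by (rule bexI[of _ 0]) simp_all
  next
    case (simplex xs r)
    show ?case
    proof (cases "k \<le> card (set xs \<inter> B) \<and> ?a xs \<notin> set xs")
      case True
      then have a: "?a xs \<notin> B" "insert (?a xs) (set xs) \<in> J" and dist: "distinct (?a xs # xs)"
        using apex[of "set xs"] simplex by auto
      let ?w = "\<lambda>ys. r * oriented_simplex (?a xs # xs) ys"
      have "oriented_simplex (?a xs # xs) \<in> oriented_chains J (i + 1)"
        using oriented_simplex_in_chains[OF dist, of J] a simplex by (simp add: add.commute)
      then have "?w \<in> oriented_chains J (i + 1)" by (rule chains_scale)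
      \<comment> \<open>If two simplices differ in \<open>B\<close>, then so do their cones, because apexes are outside \<open>B\<close>.\<close>
      moreover have "?w (?a ys # ys) = r * oriented_simplex xs ys" if "?a ys \<notin> B" for ys
      proof (cases "set ys \<inter> B = set xs \<inter> B")
        case True
        then show ?thesis using oriented_simplex_Cons[OF dist] by simp
      next
        case False
        have "oriented_simplex xs ys = 0"
          using False oriented_simplex_set[of xs ys] by auto
        moreover have "oriented_simplex (?a xs # xs) (?a ys # ys) = 0"
        proof (rule ccontr)
          assume "oriented_simplex (?a xs # xs) (?a ys # ys) \<noteq> 0"
          then have "set (?a ys # ys) = set (?a xs # xs)"
            by (rule oriented_simplex_set)
          then have "set (?a ys # ys) \<inter> B = set (?a xs # xs) \<inter> B" by simp
          then show False using False a(1) that by simp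
        qed
        ultimately show ?thesis by simp
      qed
      moreover have "k \<le> card (set ys \<inter> B) \<and> ?a ys \<in> set ys" if "?w ys \<noteq> 0" for ys
      proof -
        have "set ys = set (?a xs # xs)"
          using that by (intro oriented_simplex_set) auto
        then show ?thesis using True a(1) by simp
      qed
      ultimately show ?thesis by (intro bexI[of _ ?w]) blast+
    next
      case False
      have "oriented_simplex xs ys = 0" if "k \<le> card (set ys \<inter> B)" "?a ys \<notin> set ys" for ys
        using False that oriented_simplex_set[of xs ys] by (cases "oriented_simplex xs ys = 0") auto
      then show ?thesis by (intro bexI[of _ 0]) auto
    qed
  next
    case (add c d)
    from add(1) obtain u where u: "u \<in> oriented_chains J (i + 1)"
      "\<forall>xs. k \<le> card (set xs \<inter> B) \<longrightarrow> ?a xs \<notin> set xs \<longrightarrow> ?a xs \<notin> B \<longrightarrow> u (?a xs # xs) = c xs"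
      "\<forall>ys. u ys \<noteq> 0 \<longrightarrow> k \<le> card (set ys \<inter> B) \<and> ?a ys \<in> set ys" by blast
    from add(2) obtain v where v: "v \<in> oriented_chains J (i + 1)"
      "\<forall>xs. k \<le> card (set xs \<inter> B) \<longrightarrow> ?a xs \<notin> set xs \<longrightarrow> ?a xs \<notin> B \<longrightarrow> v (?a xs # xs) = d xs"
      "\<forall>ys. v ys \<noteq> 0 \<longrightarrow> k \<le> card (set ys \<inter> B) \<and> ?a ys \<in> set ys" by blast
    have "u ys \<noteq> 0 \<or> v ys \<noteq> 0" if "(u + v) ys \<noteq> 0" for ys using that by auto
    then show ?case
      using u v by (intro bexI[of _ "u + v"] chains_add conjI allI impI) (simp, blast+)
  qed
  then show thesis using that by blast
qed

text \<open>The homotopy identity \<open>\<partial>(a * z) = z - a * \<partial>z\<close> for the cone \<open>w = a * z\<close>, read off at simplices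
  with the largest number \<open>m\<close> of vertices in \<open>B\<close>.  At those the boundary does not see the
  vertices in \<open>B\<close>, the apex is constant, and \<open>\<partial>z\<close> vanishes; so \<open>\<partial>w\<close> agrees with \<open>z\<close> there.\<close>

lemma cone_step:
  assumes J: "simplicial_complex J"
    and apex: "\<And>\<tau>. \<tau> \<in> J \<Longrightarrow> k \<le> card (\<tau> \<inter> B) \<Longrightarrow> a (\<tau> \<inter> B) \<notin> B \<and> insert (a (\<tau> \<inter> B)) \<tau> \<in> J"
    and z: "z \<in> oriented_chains J i"
    and bd: "\<And>ys. boundary z ys \<noteq> 0 \<Longrightarrow> card (set ys \<inter> B) < k"
    and m: "k \<le> m" "\<And>xs. z xs \<noteq> 0 \<Longrightarrow> card (set xs \<inter> B) \<le> m"
  obtains w where "w \<in> oriented_chains J (i + 1)"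
    and "\<And>xs. (z - boundary w) xs \<noteq> 0 \<Longrightarrow> card (set xs \<inter> B) < m"
proof -
  let ?a = "\<lambda>xs. a (set xs \<inter> B)"
  \<comment> \<open>Taking the cone inside \<open>J'\<close> keeps the number of vertices in \<open>B\<close> at most \<open>m\<close>.\<close>
  define J' where "J' = {\<tau> \<in> J. card (\<tau> \<inter> B) \<le> m}"
  have "J' \<subseteq> J" by (auto simp: J'_def)
  have apex': "a (\<tau> \<inter> B) \<notin> B \<and> insert (a (\<tau> \<inter> B)) \<tau> \<in> J'" if "\<tau> \<in> J'" "k \<le> card (\<tau> \<inter> B)" for \<tau>
    using apex[of \<tau>] that by (simp add: J'_def)
  have z': "z \<in> oriented_chains J' i"
    using z by (rule chains_subcomplex) (simp add: J'_def m(2) chainsD(2)[OF z])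
  obtain w where w: "w \<in> oriented_chains J' (i + 1)"
    and cone: "\<And>xs. k \<le> card (set xs \<inter> B) \<Longrightarrow> ?a xs \<notin> set xs \<Longrightarrow> ?a xs \<notin> B \<Longrightarrow> w (?a xs # xs) = z xs"
    and supp: "\<And>ys. w ys \<noteq> 0 \<Longrightarrow> k \<le> card (set ys \<inter> B) \<and> ?a ys \<in> set ys"
    by (rule cone_chain_exists[where J = J' and k = k and B = B and a = a, OF apex' z'])
      (assumption+, rule that)
  have wJ: "w \<in> oriented_chains J (i + 1)" using w chains_mono[OF \<open>J' \<subseteq> J\<close>] by blast
  define y where "y = z - boundary w"
  have y: "y \<in> oriented_chains J i"
    unfolding y_def by (intro chains_diff z boundary_in_chains J wJ)
  \<comment> \<open>So a simplex with \<open>m\<close> vertices in \<open>B\<close> is a face only by omission of a vertex outside \<open>B\<close>.\<close>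
  have top: "v \<notin> B" if "c \<in> oriented_chains J' j" "c (v # xs) \<noteq> 0" "m \<le> card (set xs \<inter> B)" for c j v xs
  proof
    assume "v \<in> B"
    moreover have "card (set (v # xs) \<inter> B) \<le> m" "v \<notin> set xs"
      using chainsD[OF that(1,2)] by (auto simp: J'_def)
    ultimately show False using that(3) by simp
  qed
  have "y xs = 0" if mc: "m \<le> card (set xs \<inter> B)" for xs
  proof (rule ccontr)
    assume nz: "y xs \<noteq> 0"
    note D = chainsD[OF y nz]
    have kc: "k \<le> card (set xs \<inter> B)" using m(1) mc by simp
    then have aB: "?a xs \<notin> B" using apex D(2) by blast
    show False
    proof (cases "?a xs \<in> set xs")
      case False
      \<comment> \<open>The only simplex in the support of \<open>w\<close> having \<open>xs\<close> as a face is the cone over \<open>xs\<close>.\<close>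
      have "boundary w xs = (\<Sum>v\<in>{?a xs}. w (v # xs))"
      proof (rule boundary_superset)
        fix v assume v: "w (v # xs) \<noteq> 0"
        then have "v \<notin> B" using top[OF w v mc] by simp
        then show "v \<in> {?a xs}" using supp[OF v] False by simp
      qed simp
      then have "boundary w xs = z xs" using cone[OF kc False aB] by simp
      then show False using nz by (simp add: y_def)
    next
      case True
      \<comment> \<open>Here \<open>xs\<close> is itself a cone over \<open>ys\<close>, and the coefficients of \<open>w\<close> around it are those of
        \<open>z\<close> around \<open>ys\<close> with opposite sign, except at \<open>xs\<close>; their sum is found from
        \<open>\<partial>z\<close> being \<open>0\<close> at \<open>ys\<close>.\<close>
      define b where "b = ?a xs"
      from True obtain us vs where xs: "xs = us @ b # vs"
        unfolding b_def by (meson split_list)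
      define ys where "ys = us @ vs"
      have "y (b # ys) = (- 1) ^ length us * y xs"
        using chains_move_front[OF y, of "[]" b us vs] by (simp add: xs ys_def)
      then have nz': "y (b # ys) \<noteq> 0" using nz by simp
      have bB: "b \<notin> B" using aB by (simp add: b_def)
      have S: "set ys \<inter> B = set xs \<inter> B" using bB by (auto simp: xs ys_def)
      have b_ys: "b \<notin> set ys" using D(1) by (auto simp: xs ys_def)
      have ab: "a (set ys \<inter> B) = b" by (simp add: S b_def)
      have swap: "w (v # b # ys) = (if v = b then 0 else - z (v # ys))" for v
      proof (cases "v \<in> B \<or> v = b")
        case True
        have "w (v # b # ys) = 0"
        proof (rule ccontr)
          assume "w (v # b # ys) \<noteq> 0"
          then have "v \<notin> B" "v \<noteq> b"
            using top[OF w, of v "b # ys"] chainsD(1)[OF w, of "v # b # ys"] mc S bB by auto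
          with True show False by blast
        qed
        moreover have "z (v # ys) = 0" if "v \<in> B"
          using top[OF z', of v ys] that mc S by auto
        ultimately show ?thesis using True by auto
      next
        case False
        then have "set (v # ys) \<inter> B = set xs \<inter> B" using S by simp
        then have "w (b # v # ys) = z (v # ys)"
          using cone[of "v # ys"] kc False b_ys bB by (auto simp: b_def)
        moreover have "w (v # b # ys) = - w (b # v # ys)"
          using chains_swap[OF w, of 0 1 "b # v # ys"] by simp
        ultimately show ?thesis using False by simp
      qed
      define V where "V = {v. z (v # ys) \<noteq> 0} \<union> {b}"
      have V: "finite V" unfolding V_def by (simp add: finite_heads[OF chains_finite[OF z]])
      have "boundary w (b # ys) = (\<Sum>v\<in>V. w (v # b # ys))"
        by (rule boundary_superset[OF V]) (auto simp: swap V_def split: if_splits)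
      also have "\<dots> = (\<Sum>v\<in>V. (if v = b then z (v # ys) else 0) - z (v # ys))"
        by (rule sum.cong) (simp_all add: swap)
      also have "\<dots> = z (b # ys) - (\<Sum>v\<in>V. z (v # ys))"
        using V by (simp add: sum_subtractf V_def)
      also have "(\<Sum>v\<in>V. z (v # ys)) = boundary z ys"
        by (rule boundary_superset[OF V, symmetric]) (simp add: V_def)
      also have "boundary z ys = 0" using bd[of ys] kc S by force
      finally show False using nz' by (simp add: y_def)
    qed
  qed
  then show thesis using that[OF wJ] unfolding y_def by (meson not_le_imp_less)
qed

text \<open>The vanishing of the relative homology \<open>H(J, K)\<close>.  A chain is a finite combination of
  simplices, so finitely many applications of the previous lemma bring it into the subcomplex.\<close>

lemma relative_cycle_homologous_to_subcomplex:
  assumes J: "simplicial_complex J"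
    and apex: "\<And>\<tau>. \<tau> \<in> J \<Longrightarrow> k \<le> card (\<tau> \<inter> B) \<Longrightarrow> a (\<tau> \<inter> B) \<notin> B \<and> insert (a (\<tau> \<inter> B)) \<tau> \<in> J"
    and K: "K = {\<tau> \<in> J. card (\<tau> \<inter> B) < k}"
    and z: "z \<in> oriented_chains J i"
    and bd: "\<And>ys. boundary z ys \<noteq> 0 \<Longrightarrow> set ys \<in> K"
  obtains w where "w \<in> oriented_chains J (i + 1)" "z - boundary w \<in> oriented_chains K i"
proof -
  have "\<exists>w\<in>oriented_chains J (i + 1). z - boundary w \<in> oriented_chains K i"
    if "z \<in> oriented_chains J i" "\<And>xs. z xs \<noteq> 0 \<Longrightarrow> card (set xs \<inter> B) < k + n"
      "\<And>ys. boundary z ys \<noteq> 0 \<Longrightarrow> set ys \<in> K" for n z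
    using that
  proof (induction n arbitrary: z)
    case 0
    have "z \<in> oriented_chains K i"
      using 0 chainsD(2)[OF 0(1)] by (intro chains_subcomplex[OF 0(1)]) (simp add: K)
    then have "z - boundary 0 \<in> oriented_chains K i" by (simp only: boundary_zero diff_zero)
    then show ?case using chains_zero by (rule bexI)
  next
    case (Suc n)
    have le: "card (set xs \<inter> B) \<le> k + n" if "z xs \<noteq> 0" for xs
      using Suc.prems(2)[OF that] by simp
    have lt: "card (set ys \<inter> B) < k" if "boundary z ys \<noteq> 0" for ys
      using Suc.prems(3)[OF that] by (simp add: K)
    obtain w where w: "w \<in> oriented_chains J (i + 1)"
      "\<And>xs. (z - boundary w) xs \<noteq> 0 \<Longrightarrow> card (set xs \<inter> B) < k + n"
      by (rule cone_step[where k = k and B = B and a = a, OF J apex Suc.prems(1) lt le_add1 le])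
        (assumption+, rule that)
    have y: "z - boundary w \<in> oriented_chains J i"
      by (intro chains_diff Suc.prems(1) boundary_in_chains J w(1))
    have "boundary (z - boundary w) = boundary z"
      using boundary_boundary[OF w(1)]
      by (subst boundary_diff) (simp_all add: chains_finite[OF Suc.prems(1)]
          chains_finite[OF boundary_in_chains[OF J w(1)]])
    then have bd: "set ys \<in> K" if "boundary (z - boundary w) ys \<noteq> 0" for ys
      using Suc.prems(3)[of ys] that by simp
    obtain u where u: "u \<in> oriented_chains J (i + 1)"
      "z - boundary w - boundary u \<in> oriented_chains K i"
      using Suc.IH[OF y w(2) bd] by blast
    have mu: "- u \<in> oriented_chains J (i + 1)" using chains_diff[OF chains_zero u(1)] by simp
    have "boundary (w - (- u)) = boundary w - boundary (- u)"
      by (intro boundary_diff chains_finite[OF w(1)] chains_finite[OF mu])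
    moreover have "boundary (0 - u) = boundary 0 - boundary u"
      by (intro boundary_diff chains_finite[OF u(1)]) simp
    ultimately have "boundary (w + u) = boundary w + boundary u" by simp
    then have "z - boundary (w + u) \<in> oriented_chains K i" using u(2) by (simp only: diff_diff_eq)
    then show ?case using chains_add[OF w(1) u(1)] by (rule bexI)
  qed
  moreover have "\<exists>n. \<forall>xs. z xs \<noteq> 0 \<longrightarrow> card (set xs \<inter> B) < k + n"
  proof (intro exI allI impI)
    fix xs assume "z xs \<noteq> 0"
    then have "card (set xs \<inter> B) \<le> Max ((\<lambda>xs. card (set xs \<inter> B)) ` {xs. z xs \<noteq> 0})"
      using chains_finite[OF z] by (intro Max_ge) auto
    then show "card (set xs \<inter> B) < k + Suc (Max ((\<lambda>xs. card (set xs \<inter> B)) ` {xs. z xs \<noteq> 0}))"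
      by simp
  qed
  ultimately have "\<exists>w\<in>oriented_chains J (i + 1). z - boundary w \<in> oriented_chains K i"
    using z bd by blast
  then show thesis using that by blast
qed

text \<open>The consequence of the vanishing of \<open>H(J, K)\<close> for \<open>H(K) \<rightarrow> H(J)\<close>: injectivity is the
  second and surjectivity the third statement, as in the long exact sequence of the pair.\<close>

lemma homology_of_apex_subcomplex:
  assumes J: "simplicial_complex J"
    and cone: "\<forall>\<tau>\<in>J. k \<le> card (\<tau> \<inter> B) \<longrightarrow> a (\<tau> \<inter> B) \<notin> B \<and> insert (a (\<tau> \<inter> B)) \<tau> \<in> J"
    and K: "K = {\<tau> \<in> J. card (\<tau> \<inter> B) < k}"
  shows "cycles K i \<subseteq> cycles J i"
    and "cycles K i \<inter> boundaries J i = boundaries K i"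
    and "z \<in> cycles J i \<Longrightarrow> \<exists>y\<in>cycles K i. z - y \<in> boundaries J i"
proof -
  have apex: "a (\<tau> \<inter> B) \<notin> B \<and> insert (a (\<tau> \<inter> B)) \<tau> \<in> J" if "\<tau> \<in> J" "k \<le> card (\<tau> \<inter> B)" for \<tau>
    using cone that by simp
  have sub: "oriented_chains K j \<subseteq> oriented_chains J j" for j
    by (rule chains_mono) (simp add: K)
  then show cyc: "cycles K i \<subseteq> cycles J i" by (auto simp: cycles_def)
  have J_sub: "\<sigma> \<in> J" if "\<tau> \<in> J" "\<sigma> \<subseteq> \<tau>" for \<sigma> \<tau>
    using J that unfolding simplicial_complex_def by blast
  have J_fin: "finite \<tau>" if "\<tau> \<in> J" for \<tau> using J that by (simp add: simplicial_complex_def)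
  have K_sub: "\<sigma> \<in> J \<and> card (\<sigma> \<inter> B) < k" if "\<tau> \<in> K" "\<sigma> \<subseteq> \<tau>" for \<sigma> \<tau>
  proof -
    have "\<tau> \<in> J" using that by (simp add: K)
    moreover have "card (\<sigma> \<inter> B) \<le> card (\<tau> \<inter> B)"
      using J_fin[OF \<open>\<tau> \<in> J\<close>] that(2) by (intro card_mono) auto
    ultimately show ?thesis using that J_sub[of \<tau> \<sigma>] by (simp add: K)
  qed
  have bdK: "set ys \<in> K" if c: "c \<in> oriented_chains K j" and nz: "boundary c ys \<noteq> 0" for c j ys
  proof -
    obtain v where "c (v # ys) \<noteq> 0"
      using nz unfolding boundary_def by (rule sum.not_neutral_contains_not_neutral) auto
    then have "set (v # ys) \<in> K" by (rule chainsD(2)[OF c])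
    then show ?thesis using K_sub[of "set (v # ys)" "set ys"] by (auto simp: K)
  qed
  show "cycles K i \<inter> boundaries J i = boundaries K i"
  proof (intro equalityI subsetI)
    fix x assume "x \<in> cycles K i \<inter> boundaries J i"
    then obtain u where x: "x \<in> oriented_chains K i"
      and u: "u \<in> oriented_chains J (i + 1)" "x = boundary u"
      by (auto simp: cycles_def boundaries_def)
    \<comment> \<open>\<open>u\<close> is a relative cycle since its boundary \<open>x\<close> lies in \<open>K\<close>.\<close>
    obtain w where w: "w \<in> oriented_chains J (i + 1 + 1)" "u - boundary w \<in> oriented_chains K (i + 1)"
      by (rule relative_cycle_homologous_to_subcomplex[OF J apex K u(1)])
        (use chainsD(2)[OF x] u(2) in auto)
    have "boundary (u - boundary w) = boundary u - boundary (boundary w)"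
      by (intro boundary_diff chains_finite[OF u(1)] chains_finite[OF boundary_in_chains[OF J w(1)]])
    then have "boundary (u - boundary w) = x" using boundary_boundary[OF w(1)] u(2) by simp
    then show "x \<in> boundaries K i" unfolding boundaries_def using w(2) by blast
  next
    fix x assume "x \<in> boundaries K i"
    then obtain u where u: "u \<in> oriented_chains K (i + 1)" "x = boundary u"
      by (auto simp: boundaries_def)
    have uJ: "u \<in> oriented_chains J (i + 1)" using u(1) sub by blast
    have "x \<in> oriented_chains K i"
      unfolding u(2) by (rule chains_subcomplex[OF boundary_in_chains[OF J uJ] bdK[OF u(1)]])
    then show "x \<in> cycles K i \<inter> boundaries J i"
      using boundary_boundary[OF uJ] u(2) uJ by (simp add: cycles_def boundaries_def)
  qed
  show "\<exists>y\<in>cycles K i. z - y \<in> boundaries J i" if "z \<in> cycles J i"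
  proof -
    have z: "z \<in> oriented_chains J i" "boundary z = 0" using that by (auto simp: cycles_def)
    obtain w where w: "w \<in> oriented_chains J (i + 1)" "z - boundary w \<in> oriented_chains K i"
      by (rule relative_cycle_homologous_to_subcomplex[OF J apex K z(1)]) (use z(2) in auto)
    have "boundary (z - boundary w) = boundary z - boundary (boundary w)"
      by (intro boundary_diff chains_finite[OF z(1)] chains_finite[OF boundary_in_chains[OF J w(1)]])
    then have "z - boundary w \<in> cycles K i"
      using boundary_boundary[OF w(1)] z(2) w(2) by (simp add: cycles_def)
    moreover have "z - (z - boundary w) \<in> boundaries J i" using w(1) by (simp add: boundaries_def)
    ultimately show ?thesis by blast
  qed
qed


section \<open>Isomorphisms of quotient modules\<close>

text \<open>The conditions under which the operations of \<open>quotient_module Z B act\<close> may be computed on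
  representatives.\<close>

locale quotient_data =
  fixes R :: "('r, 's) ring_scheme" and Z B :: "'m::ab_group_add set" and act :: "'r \<Rightarrow> 'm \<Rightarrow> 'm"
  assumes Z: "0 \<in> Z" "\<And>x y. x \<in> Z \<Longrightarrow> y \<in> Z \<Longrightarrow> x - y \<in> Z"
    and B: "B \<subseteq> Z" "0 \<in> B" "\<And>x y. x \<in> B \<Longrightarrow> y \<in> B \<Longrightarrow> x - y \<in> B"
    and act_Z: "\<And>r x. r \<in> carrier R \<Longrightarrow> x \<in> Z \<Longrightarrow> act r x \<in> Z"
    and act_B: "\<And>r x. r \<in> carrier R \<Longrightarrow> x \<in> B \<Longrightarrow> act r x \<in> B"
    and act_diff: "\<And>r x y. r \<in> carrier R \<Longrightarrow> x \<in> Z \<Longrightarrow> y \<in> Z \<Longrightarrow> act r (x - y) = act r x - act r y"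
begin

abbreviation coset :: "'m \<Rightarrow> 'm set" where "coset x \<equiv> quot_rel Z B `` {x}"

lemma Z_add: "x \<in> Z \<Longrightarrow> y \<in> Z \<Longrightarrow> x + y \<in> Z"
  using Z(2)[of x "0 - y"] Z(2)[OF Z(1), of y] by simp

lemma B_minus: "x \<in> B \<Longrightarrow> - x \<in> B"
  using B(3)[OF B(2), of x] by simp

lemma B_add: "x \<in> B \<Longrightarrow> y \<in> B \<Longrightarrow> x + y \<in> B"
  using B(3)[of x "- y"] B_minus[of y] by simp

lemma coset_eq_iff:
  assumes "x \<in> Z" "y \<in> Z"
  shows "coset x = coset y \<longleftrightarrow> x - y \<in> B"
proof
  assume "coset x = coset y"
  moreover have "y \<in> coset y" using assms B(2) by (simp add: quot_rel_def)
  ultimately show "x - y \<in> B" by (auto simp: quot_rel_def)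
next
  assume *: "x - y \<in> B"
  have "x - u \<in> B \<longleftrightarrow> y - u \<in> B" for u
    using B_add[OF *, of "y - u"] B(3)[of "x - u" "x - y"] * by auto
  then show "coset x = coset y" using assms by (auto simp: quot_rel_def)
qed

lemma coset_nonempty: "x \<in> Z \<Longrightarrow> coset x \<noteq> {}"
  using B(2) by (auto simp: quot_rel_def)

lemma carrier_quotient: "carrier (quotient_module Z B act) = coset ` Z"
  by (auto simp: quotient_module_def quotient_def)

lemma add_quotient:
  assumes "x \<in> Z" "y \<in> Z"
  shows "coset x \<oplus>\<^bsub>quotient_module Z B act\<^esub> coset y = coset (x + y)"
proof -
  have "coset (u + v) = coset (x + y)" if "u \<in> coset x" "v \<in> coset y" for u v
  proof -
    have uv: "u \<in> Z" "v \<in> Z" "x - u \<in> B" "y - v \<in> B" using that by (auto simp: quot_rel_def)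
    have "(x + y) - (u + v) \<in> B" using B_add[OF uv(3,4)] by (simp add: algebra_simps)
    then show ?thesis using coset_eq_iff[of "x + y" "u + v"] uv assms by (simp add: Z_add)
  qed
  then have "(\<Union>u\<in>coset x. \<Union>v\<in>coset y. coset (u + v)) = (\<Union>u\<in>coset x. \<Union>v\<in>coset y. coset (x + y))"
    by (intro SUP_cong refl)
  moreover have "coset x \<noteq> {}" "coset y \<noteq> {}" using coset_nonempty assms by blast+
  ultimately have "(\<Union>u\<in>coset x. \<Union>v\<in>coset y. coset (u + v)) = coset (x + y)" by simp
  then show ?thesis by (simp add: quotient_module_def)
qed

lemma smult_quotient:
  assumes "r \<in> carrier R" "x \<in> Z"
  shows "r \<odot>\<^bsub>quotient_module Z B act\<^esub> coset x = coset (act r x)"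
proof -
  have "coset (act r u) = coset (act r x)" if "u \<in> coset x" for u
  proof -
    have u: "u \<in> Z" "x - u \<in> B" using that by (auto simp: quot_rel_def)
    have "act r x - act r u \<in> B" using act_B[OF assms(1) u(2)] act_diff assms u by simp
    then show ?thesis using coset_eq_iff[of "act r x" "act r u"] act_Z assms u by simp
  qed
  then have "(\<Union>u\<in>coset x. coset (act r u)) = (\<Union>u\<in>coset x. coset (act r x))"
    by (intro SUP_cong refl)
  moreover have "coset x \<noteq> {}" using coset_nonempty assms by blast
  ultimately have "(\<Union>u\<in>coset x. coset (act r u)) = coset (act r x)" by simp
  then show ?thesis by (simp add: quotient_module_def)
qed

end

text \<open>Both quotients are identified with \<open>Z / B\<close> through the inclusions of \<open>Z\<^sub>1\<close> and \<open>Z\<^sub>2\<close> into \<open>Z\<close>.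
  The isomorphism is given directly by the relation \<open>x - y \<in> B\<close> between \<open>x \<in> Z\<^sub>1\<close> and \<open>y \<in> Z\<^sub>2\<close>;
  this makes it linear whatever representatives \<open>f\<close> chooses.\<close>

lemma quotient_module_iso_common_overgroup:
  fixes Z\<^sub>1 Z\<^sub>2 Z B :: "'m::ab_group_add set"
  assumes "quotient_data R Z\<^sub>1 (Z\<^sub>1 \<inter> B) act" "quotient_data R Z\<^sub>2 (Z\<^sub>2 \<inter> B) act"
    and "quotient_data R Z B act"
    and sub: "Z\<^sub>1 \<subseteq> Z" "Z\<^sub>2 \<subseteq> Z"
    and ex: "\<And>z. z \<in> Z \<Longrightarrow> \<exists>x\<in>Z\<^sub>1. z - x \<in> B" "\<And>z. z \<in> Z \<Longrightarrow> \<exists>y\<in>Z\<^sub>2. z - y \<in> B"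
  shows "\<exists>\<phi>. \<phi> \<in> left_module_iso R (quotient_module Z\<^sub>1 (Z\<^sub>1 \<inter> B) act) (quotient_module Z\<^sub>2 (Z\<^sub>2 \<inter> B) act)"
proof -
  interpret Q1: quotient_data R Z\<^sub>1 "Z\<^sub>1 \<inter> B" act by fact
  interpret Q2: quotient_data R Z\<^sub>2 "Z\<^sub>2 \<inter> B" act by fact
  interpret Q: quotient_data R Z B act by fact
  define f where "f x = (SOME y. y \<in> Z\<^sub>2 \<and> x - y \<in> B)" for x
  have f: "f x \<in> Z\<^sub>2" "x - f x \<in> B" if "x \<in> Z\<^sub>1" for x
    using someI_ex[of "\<lambda>y. y \<in> Z\<^sub>2 \<and> x - y \<in> B"] ex(2)[of x] sub(1) that unfolding f_def by blast+
  define \<phi> where "\<phi> X = Q2.coset (f (SOME x. x \<in> X))" for X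
  have \<phi>: "\<phi> (Q1.coset x) = Q2.coset y" if "x \<in> Z\<^sub>1" "y \<in> Z\<^sub>2" "x - y \<in> B" for x y
  proof -
    define u where "u = (SOME u. u \<in> Q1.coset x)"
    have "x \<in> Q1.coset x" using that Q1.B(2) by (simp add: quot_rel_def)
    then have "u \<in> Q1.coset x" unfolding u_def by (rule someI)
    then have u: "u \<in> Z\<^sub>1" "x - u \<in> B" by (auto simp: quot_rel_def)
    have "(x - y) - (x - u) - (u - f u) \<in> B"
      using Q.B(3)[OF Q.B(3)[OF that(3) u(2)] f(2)[OF u(1)]] .
    then have "f u - y \<in> Z\<^sub>2 \<inter> B" using f(1)[OF u(1)] that(2) by (simp add: Q2.Z)
    then have "Q2.coset (f u) = Q2.coset y"
      using f(1)[OF u(1)] that(2) by (subst Q2.coset_eq_iff)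
    then show ?thesis unfolding \<phi>_def u_def .
  qed
  let ?M = "quotient_module Z\<^sub>1 (Z\<^sub>1 \<inter> B) act" and ?N = "quotient_module Z\<^sub>2 (Z\<^sub>2 \<inter> B) act"
  have "bij_betw \<phi> (carrier ?M) (carrier ?N)"
    unfolding bij_betw_def
  proof
    show "inj_on \<phi> (carrier ?M)"
    proof (rule inj_onI)
      fix X X' assume "X \<in> carrier ?M" "X' \<in> carrier ?M" and eq: "\<phi> X = \<phi> X'"
      then obtain x x' where x: "x \<in> Z\<^sub>1" "X = Q1.coset x" "x' \<in> Z\<^sub>1" "X' = Q1.coset x'"
        by (auto simp: Q1.carrier_quotient)
      have "Q2.coset (f x) = Q2.coset (f x')"
        using eq \<phi>[OF x(1) f[OF x(1)]] \<phi>[OF x(3) f[OF x(3)]] x by simp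
      then have "f x - f x' \<in> B" using Q2.coset_eq_iff f(1) x by simp
      then have "(x - f x) + (f x - f x') - (x' - f x') \<in> B"
        using Q.B(3) Q.B_add f(2) x by blast
      then have "x - x' \<in> Z\<^sub>1 \<inter> B" using x by (simp add: Q1.Z)
      then show "X = X'" using x Q1.coset_eq_iff by simp
    qed
    show "\<phi> ` carrier ?M = carrier ?N"
    proof (intro equalityI subsetI)
      fix Y assume "Y \<in> \<phi> ` carrier ?M"
      then obtain x where "x \<in> Z\<^sub>1" "Y = \<phi> (Q1.coset x)" by (auto simp: Q1.carrier_quotient)
      then show "Y \<in> carrier ?N" using \<phi>[OF _ f] f(1) by (simp add: Q2.carrier_quotient)
    next
      fix Y assume "Y \<in> carrier ?N"
      then obtain y where y: "y \<in> Z\<^sub>2" "Y = Q2.coset y" by (auto simp: Q2.carrier_quotient)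
      then obtain x where x: "x \<in> Z\<^sub>1" "y - x \<in> B" using ex(1) sub by blast
      then have "x - y \<in> B" using Q.B_minus[OF x(2)] by simp
      then have "Y = \<phi> (Q1.coset x)" using \<phi> x y by simp
      then show "Y \<in> \<phi> ` carrier ?M" using x by (simp add: Q1.carrier_quotient)
    qed
  qed
  moreover have "\<phi> (X \<oplus>\<^bsub>?M\<^esub> X') = \<phi> X \<oplus>\<^bsub>?N\<^esub> \<phi> X'" if X: "X \<in> carrier ?M" "X' \<in> carrier ?M" for X X'
  proof -
    obtain x x' where x: "x \<in> Z\<^sub>1" "X = Q1.coset x" "x' \<in> Z\<^sub>1" "X' = Q1.coset x'"
      using X by (auto simp: Q1.carrier_quotient)
    have "(x + x') - (f x + f x') \<in> B"
      using Q.B_add[OF f(2)[OF x(1)] f(2)[OF x(3)]] by (simp add: algebra_simps)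
    then have "\<phi> (Q1.coset (x + x')) = Q2.coset (f x + f x')"
      by (intro \<phi> Q1.Z_add Q2.Z_add f(1) x)
    then show ?thesis
      using x f by (simp add: Q1.add_quotient Q2.add_quotient \<phi>[OF x(1) f[OF x(1)]] \<phi>[OF x(3) f[OF x(3)]])
  qed
  moreover have "\<phi> (r \<odot>\<^bsub>?M\<^esub> X) = r \<odot>\<^bsub>?N\<^esub> \<phi> X" if r: "r \<in> carrier R" and X: "X \<in> carrier ?M" for r X
  proof -
    obtain x where x: "x \<in> Z\<^sub>1" "X = Q1.coset x"
      using X by (auto simp: Q1.carrier_quotient)
    have "act r x - act r (f x) \<in> B"
      using Q.act_B[OF r f(2)[OF x(1)]] Q.act_diff[OF r] x(1) f(1) sub by (metis subsetD)
    then have "\<phi> (Q1.coset (act r x)) = Q2.coset (act r (f x))"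
      by (intro \<phi> Q1.act_Z Q2.act_Z r f(1) x)
    then show ?thesis
      using x f r by (simp add: Q1.smult_quotient Q2.smult_quotient \<phi>[OF x(1) f[OF x(1)]])
  qed
  ultimately have "\<phi> \<in> left_module_iso R ?M ?N"
    unfolding left_module_iso_def by blast
  then show ?thesis by (intro exI[of _ \<phi>])
qed

lemma quotient_data_homology:
  assumes K: "simplicial_complex K" "\<And>g \<sigma>. g \<in> carrier \<Gamma> \<Longrightarrow> \<sigma> \<in> K \<Longrightarrow> g ` \<sigma> \<in> K"
    and bij: "\<And>g. g \<in> carrier \<Gamma> \<Longrightarrow> bij g"
  shows "quotient_data (group_algebra \<Gamma>) (cycles K i) (boundaries K i) algebra_act"
proof -
  let ?R = "group_algebra \<Gamma>"
  have fin: "finite {g. r g \<noteq> 0}" and GI: "\<And>g. r g \<noteq> 0 \<Longrightarrow> g \<in> carrier \<Gamma>" if "r \<in> carrier ?R" for r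
    using that by (auto simp: carrier_group_algebra)
  have actc: "chain_act g c \<in> oriented_chains K j" if "g \<in> carrier \<Gamma>" "c \<in> oriented_chains K j" for g c j
    using chain_act_in_chains[OF bij K(2)] that by blast
  have algc: "algebra_act r c \<in> oriented_chains K j"
    if "r \<in> carrier ?R" "c \<in> oriented_chains K j" for r c j
    using algebra_act_in_chains[OF fin[OF that(1)]] actc GI[OF that(1)] that(2) by blast
  have bd: "boundary (algebra_act r c) = algebra_act r (boundary c)"
    if "r \<in> carrier ?R" "c \<in> oriented_chains K j" for r c j
    using boundary_algebra_act[OF fin[OF that(1)]] bij GI[OF that(1)] actc chains_finite that(2)
    by metis
  show ?thesis
  proof (unfold_locales, goal_cases)
    case 1
    show ?case by (simp add: cycles_def)
  next
    case (2 x y)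
    then have "boundary (x - y) = boundary x - boundary y"
      by (intro boundary_diff chains_finite) (auto simp: cycles_def)
    with 2 show ?case by (simp add: cycles_def chains_diff)
  next
    case 3
    show ?case
      unfolding boundaries_def cycles_def
      using boundary_in_chains[OF K(1)] boundary_boundary by blast
  next
    case 4
    show ?case unfolding boundaries_def by (rule image_eqI[of _ _ 0]) simp_all
  next
    case (5 x y)
    then obtain c d where cd: "x = boundary c" "y = boundary d"
      "c \<in> oriented_chains K (i + 1)" "d \<in> oriented_chains K (i + 1)"
      by (auto simp: boundaries_def)
    then have "boundary (c - d) = x - y"
      using boundary_diff[OF chains_finite[OF cd(3)] chains_finite[OF cd(4)]] by simp
    then show ?case
      unfolding boundaries_def using chains_diff[OF cd(3,4)] by (metis image_eqI)
  next
    case (6 r x)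
    have "algebra_act r 0 = 0" by (rule ext) (simp add: algebra_act_def chain_act_def)
    with 6 show ?case using algc bd by (fastforce simp: cycles_def)
  next
    case (7 r x)
    then obtain c where "x = boundary c" "c \<in> oriented_chains K (i + 1)" by (auto simp: boundaries_def)
    with 7 show ?case
      unfolding boundaries_def by (intro image_eqI[of _ _ "algebra_act r c"]) (simp_all add: algc bd)
  next
    case (8 r x y)
    show ?case
      by (rule ext) (simp add: algebra_act_def chain_act_def algebra_simps sum_subtractf)
  qed
qed


section \<open>The complex joining the order complex to the cross-cut complex\<close>

text \<open>The order complex and the cross-cut complex share the vertices in \<open>C\<close>, so they are not
  joined along disjoint vertex sets.  As \<open>C\<close> is an antichain, the conditions below say
  that a simplex is a chain, or the union of a simplex of \<open>crosscut_complex C\<close> and a chain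
  outside \<open>C\<close> all of whose elements are comparable to it.  With \<open>'a\<close> as the type
  of vertices, the group algebra acting on the three homology modules is the same.\<close>

definition joint_complex :: "'a::bounded_lattice set \<Rightarrow> 'a set set" where
  "joint_complex C = {\<tau>. finite \<tau> \<and> Orderings.bot \<notin> \<tau> \<and> Orderings.top \<notin> \<tau> \<and>
    (\<forall>x\<in>\<tau>. \<forall>y\<in>\<tau>. x \<le> y \<or> y \<le> x \<or> x \<in> C \<and> y \<in> C) \<and> \<tau> \<inter> C \<in> crosscut_complex C}"

lemma simplicial_complex_joint_complex: "simplicial_complex (joint_complex C)"
proof -
  have "\<sigma> \<in> joint_complex C" if "\<tau> \<in> joint_complex C" "\<sigma> \<subseteq> \<tau>" for \<sigma> \<tau>
  proof -
    have "\<tau> \<inter> C \<in> crosscut_complex C" "\<sigma> \<inter> C \<subseteq> \<tau> \<inter> C"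
      using that by (auto simp: joint_complex_def)
    then have "\<sigma> \<inter> C \<in> crosscut_complex C"
      using simplicial_complex_crosscut_complex[of C] by (simp add: simplicial_complex_def)
    moreover have "finite \<sigma>" using that finite_subset[OF that(2)] by (simp add: joint_complex_def)
    moreover have "Orderings.bot \<notin> \<sigma>" "Orderings.top \<notin> \<sigma>"
      using that by (auto simp: joint_complex_def)
    ultimately show ?thesis using that by (simp add: joint_complex_def subset_iff)
  qed
  moreover have "{} \<in> joint_complex C"
    by (simp add: joint_complex_def crosscut_complex_def spans_def)
  moreover have "finite \<tau>" if "\<tau> \<in> joint_complex C" for \<tau>
    using that by (simp add: joint_complex_def)
  ultimately show ?thesis unfolding simplicial_complex_def by blast
qed

lemma image_joint_complex:
  assumes g: "g \<in> carrier lattice_Aut" and C: "g ` C = C" and \<tau>: "\<tau> \<in> joint_complex C"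
  shows "g ` \<tau> \<in> joint_complex C"
proof -
  have inj: "inj g" using lattice_AutD(1)[OF g] by (rule bij_is_inj)
  have \<tau>': "finite \<tau>" "Orderings.bot \<notin> \<tau>" "Orderings.top \<notin> \<tau>" "\<tau> \<inter> C \<in> crosscut_complex C"
    "\<And>x y. x \<in> \<tau> \<Longrightarrow> y \<in> \<tau> \<Longrightarrow> x \<le> y \<or> y \<le> x \<or> x \<in> C \<and> y \<in> C"
    using \<tau> by (auto simp: joint_complex_def)
  have "Orderings.bot \<notin> g ` \<tau>" "Orderings.top \<notin> g ` \<tau>"
    using \<tau>'(2,3) inj_image_mem_iff[OF inj] lattice_Aut_bot_top[OF g] by metis+
  moreover have "g ` \<tau> \<inter> C = g ` (\<tau> \<inter> C)" using C image_Int[OF inj] by metis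
  moreover have "g x \<le> g y \<or> g y \<le> g x \<or> g x \<in> C \<and> g y \<in> C" if "x \<in> \<tau>" "y \<in> \<tau>" for x y
    using \<tau>'(5)[OF that] lattice_Aut_le[OF g] C by blast
  ultimately show ?thesis
    using image_crosscut_complex[OF g C \<tau>'(4)] \<tau>'(1) by (simp add: joint_complex_def)
qed

lemma crosscutD:
  assumes "crosscut C"
  shows "Orderings.bot \<notin> C" "Orderings.top \<notin> C" "\<And>x y. x \<in> C \<Longrightarrow> y \<in> C \<Longrightarrow> x \<le> y \<Longrightarrow> x = y"
proof -
  show "Orderings.bot \<notin> C" "Orderings.top \<notin> C" using assms by (simp_all add: crosscut_def)
  have "\<forall>x\<in>C. \<forall>y\<in>C. x \<noteq> y \<longrightarrow> \<not> x \<le> y" using assms by (simp add: crosscut_def)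
  then show "x = y" if "x \<in> C" "y \<in> C" "x \<le> y" for x y using that by blast
qed

text \<open>Distinct elements of \<open>C\<close> are incomparable, so a simplex of the joint complex is a chain exactly
  if it contains at most one of them; and a single element of \<open>C\<close> does not span.\<close>

lemma order_complex_eq_joint_complex:
  assumes C: "crosscut C"
  shows "order_complex = {\<tau> \<in> joint_complex C. card (\<tau> \<inter> C) < 2}"
proof -
  have le1: "card (\<tau> \<inter> C) < 2 \<longleftrightarrow> (\<forall>x\<in>\<tau> \<inter> C. \<forall>y\<in>\<tau> \<inter> C. x = y)" if "finite \<tau>" for \<tau>
    using card_le_Suc0_iff_eq[of "\<tau> \<inter> C"] that by auto
  have small: "S \<in> crosscut_complex C" if S: "finite S" "S \<subseteq> C" "\<And>x y. x \<in> S \<Longrightarrow> y \<in> S \<Longrightarrow> x = y" for S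
  proof (cases "S = {}")
    case True
    then show ?thesis by (simp add: crosscut_complex_def spans_def)
  next
    case False
    then obtain c where "S = {c}" using S(3) by blast
    then show ?thesis using S(2) crosscutD(1)[OF C] by (auto simp: crosscut_complex_def spans_def)
  qed
  show ?thesis
  proof (intro equalityI subsetI)
    fix \<tau> :: "'a set" assume \<tau>: "\<tau> \<in> order_complex"
    then have ch: "x \<le> y \<or> y \<le> x" if "x \<in> \<tau>" "y \<in> \<tau>" for x y
      using that by (auto simp: order_complex_def chain_def)
    have fin: "finite \<tau>" using \<tau> by (simp add: order_complex_def)
    have eq: "x = y" if "x \<in> \<tau> \<inter> C" "y \<in> \<tau> \<inter> C" for x y
      using ch[of x y] that crosscutD(3)[OF C] by blast
    show "\<tau> \<in> {\<tau> \<in> joint_complex C. card (\<tau> \<inter> C) < 2}"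
      using \<tau> small[of "\<tau> \<inter> C"] ch eq fin le1[OF fin]
      by (auto simp: joint_complex_def order_complex_def)
  next
    fix \<tau> assume "\<tau> \<in> {\<tau> \<in> joint_complex C. card (\<tau> \<inter> C) < 2}"
    then have \<tau>: "\<tau> \<in> joint_complex C" "card (\<tau> \<inter> C) < 2" by auto
    then have "finite \<tau>" by (simp add: joint_complex_def)
    then have "\<forall>x\<in>\<tau> \<inter> C. \<forall>y\<in>\<tau> \<inter> C. x = y" using le1 \<tau>(2) by blast
    moreover have "x \<le> y \<or> y \<le> x \<or> x \<in> C \<and> y \<in> C" if "x \<in> \<tau>" "y \<in> \<tau>" for x y
      using \<tau>(1) that by (simp add: joint_complex_def)
    ultimately have "x \<le> y \<or> y \<le> x" if "x \<in> \<tau>" "y \<in> \<tau>" for x y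
      using that by (metis IntI order_refl)
    with \<tau>(1) show "\<tau> \<in> order_complex"
      by (simp add: joint_complex_def order_complex_def chain_def)
  qed
qed

lemma crosscut_complex_eq_joint_complex:
  assumes C: "crosscut C"
  shows "crosscut_complex C = {\<tau> \<in> joint_complex C. card (\<tau> \<inter> - C) < 1}"
proof (intro equalityI subsetI)
  fix \<tau> assume \<tau>: "\<tau> \<in> crosscut_complex C"
  then have "\<tau> \<subseteq> C" "finite \<tau>" by (auto simp: crosscut_complex_def)
  moreover have "\<tau> \<inter> C = \<tau>" "\<tau> \<inter> - C = {}" using \<open>\<tau> \<subseteq> C\<close> by auto
  ultimately show "\<tau> \<in> {\<tau> \<in> joint_complex C. card (\<tau> \<inter> - C) < 1}"
    using \<tau> crosscutD(1,2)[OF C] by (auto simp: joint_complex_def)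
next
  fix \<tau> assume "\<tau> \<in> {\<tau> \<in> joint_complex C. card (\<tau> \<inter> - C) < 1}"
  then have \<tau>: "\<tau> \<inter> C \<in> crosscut_complex C" "finite \<tau>" "card (\<tau> \<inter> - C) = 0"
    by (auto simp: joint_complex_def)
  then have "\<tau> \<inter> C = \<tau>" by auto
  with \<tau>(1) show "\<tau> \<in> crosscut_complex C" by simp
qed

text \<open>An element \<open>x\<close> with \<open>c \<le> x \<le> d\<close> for \<open>c, d \<in> C\<close> would force \<open>c = d\<close> and hence \<open>x \<in> C\<close>.\<close>

lemma same_side_of_antichain:
  assumes C: "crosscut C" and S: "S \<subseteq> C" and x: "x \<notin> C" and cmp: "\<And>c. c \<in> S \<Longrightarrow> x \<le> c \<or> c \<le> x"
  shows "(\<forall>c\<in>S. x \<le> c) \<or> (\<forall>c\<in>S. c \<le> x)"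
proof (rule ccontr)
  assume "\<not> ?thesis"
  then obtain c d where cd: "c \<in> S" "d \<in> S" "\<not> x \<le> c" "\<not> d \<le> x" by blast
  then have le: "c \<le> x" "x \<le> d" using cmp by blast+
  then have "c = d" using crosscutD(3)[OF C] cd S by (meson order_trans subsetD)
  with le cd show False by simp
qed

definition meet_or_join :: "'a::bounded_lattice set \<Rightarrow> 'a" where
  "meet_or_join S = (if Inf_fin S \<noteq> Orderings.bot then Inf_fin S else Sup_fin S)"

text \<open>The meet of \<open>S = \<tau> \<inter> C\<close> lies below \<open>S\<close>, above every lower bound of \<open>S\<close>, and below
  every upper bound, so it is comparable to all of \<open>\<tau>\<close>; dually for the join.  Since \<open>S\<close> does not
  span, one of them is a vertex.  It is not in \<open>C\<close>, as it is comparable to two distinct elements of \<open>C\<close>.\<close>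

lemma insert_meet_or_join:
  assumes C: "crosscut C" and \<tau>: "\<tau> \<in> joint_complex C" and two: "2 \<le> card (\<tau> \<inter> C)"
  shows "meet_or_join (\<tau> \<inter> C) \<notin> C \<and> insert (meet_or_join (\<tau> \<inter> C)) \<tau> \<in> joint_complex C"
proof -
  define S where "S = \<tau> \<inter> C"
  define m where "m = meet_or_join S"
  have \<tau>': "finite \<tau>" "Orderings.bot \<notin> \<tau>" "Orderings.top \<notin> \<tau>" "S \<in> crosscut_complex C"
    "\<And>x y. x \<in> \<tau> \<Longrightarrow> y \<in> \<tau> \<Longrightarrow> x \<le> y \<or> y \<le> x \<or> x \<in> C \<and> y \<in> C"
    using \<tau> by (auto simp: joint_complex_def S_def)
  have S: "finite S" "S \<subseteq> C" "S \<subseteq> \<tau>" using \<tau>'(1) by (auto simp: S_def)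
  have "\<not> card S \<le> Suc 0" using two by (simp add: S_def)
  then obtain c d where cd: "c \<in> S" "d \<in> S" "c \<noteq> d"
    unfolding card_le_Suc0_iff_eq[OF S(1)] by blast
  have ne: "S \<noteq> {}" using cd by blast
  have sp: "\<not> (Inf_fin S = Orderings.bot \<and> Sup_fin S = Orderings.top)"
    using \<tau>'(4) ne by (simp add: crosscut_complex_def spans_def)
  have cb: "c \<noteq> Orderings.bot" "c \<noteq> Orderings.top" using cd(1) S(2) crosscutD(1,2)[OF C] by auto
  have side: "(\<forall>c\<in>S. x \<le> c) \<or> (\<forall>c\<in>S. c \<le> x)" if "x \<in> \<tau>" "x \<notin> C" for x
    by (rule same_side_of_antichain[OF C S(2) that(2)]) (use \<tau>'(5)[OF that(1)] S that in blast)
  have "m \<noteq> Orderings.bot \<and> m \<noteq> Orderings.top \<and> m \<notin> C \<and> (\<forall>x\<in>\<tau>. x \<le> m \<or> m \<le> x)"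
  proof (cases "Inf_fin S = Orderings.bot")
    case False
    then have m: "m = Inf_fin S" by (simp add: m_def meet_or_join_def)
    have le: "m \<le> x" if "x \<in> S" for x using that S by (simp add: m Inf_fin.coboundedI)
    have "m \<notin> C"
      using crosscutD(3)[OF C, of m c] crosscutD(3)[OF C, of m d] le cd S(2) by (metis subsetD)
    moreover have "m \<noteq> Orderings.top" using le[OF cd(1)] cb by (auto simp: top_unique)
    moreover have "x \<le> m \<or> m \<le> x" if x: "x \<in> \<tau>" for x
    proof (cases "x \<in> C")
      case True
      then show ?thesis using le x by (simp add: S_def)
    next
      case False
      from side[OF x this] show ?thesis
      proof
        assume "\<forall>c\<in>S. x \<le> c"
        then show ?thesis using S ne by (simp add: m Inf_fin.bounded_iff)
      next
        assume "\<forall>c\<in>S. c \<le> x"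
        then show ?thesis using le cd by (meson order_trans)
      qed
    qed
    ultimately show ?thesis using False m by simp
  next
    case True
    then have m: "m = Sup_fin S" by (simp add: m_def meet_or_join_def)
    have le: "x \<le> m" if "x \<in> S" for x using that S by (simp add: m Sup_fin.coboundedI)
    have "m \<notin> C"
      using crosscutD(3)[OF C, of c m] crosscutD(3)[OF C, of d m] le cd S(2) by (metis subsetD)
    moreover have "m \<noteq> Orderings.bot" using le[OF cd(1)] cb by (auto simp: bot_unique)
    moreover have "x \<le> m \<or> m \<le> x" if x: "x \<in> \<tau>" for x
    proof (cases "x \<in> C")
      case True
      then show ?thesis using le x by (simp add: S_def)
    next
      case False
      from side[OF x this] show ?thesis
      proof
        assume "\<forall>c\<in>S. c \<le> x"
        then show ?thesis using S ne by (simp add: m Sup_fin.bounded_iff)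
      next
        assume "\<forall>c\<in>S. x \<le> c"
        then show ?thesis using le cd by (meson order_trans)
      qed
    qed
    ultimately show ?thesis using True m sp by simp
  qed
  then have m: "m \<noteq> Orderings.bot" "m \<noteq> Orderings.top" "m \<notin> C" "\<And>x. x \<in> \<tau> \<Longrightarrow> x \<le> m \<or> m \<le> x"
    by simp_all
  have "insert m \<tau> \<inter> C \<in> crosscut_complex C" using m(3) \<tau>'(4) by (simp add: S_def)
  moreover have "x \<le> y \<or> y \<le> x \<or> x \<in> C \<and> y \<in> C" if "x \<in> insert m \<tau>" "y \<in> insert m \<tau>" for x y
    using that \<tau>'(5) m(4) by (elim insertE) auto
  ultimately have "insert m \<tau> \<in> joint_complex C"
    using m(1,2) \<tau>'(1-3) by (simp add: joint_complex_def)
  then show ?thesis using m(3) by (simp add: m_def S_def)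
qed

definition comparable_cut_element :: "'a::bounded_lattice set \<Rightarrow> 'a set \<Rightarrow> 'a" where
  "comparable_cut_element C \<sigma> = (SOME c. c \<in> C \<and> (\<forall>x\<in>\<sigma>. x \<le> c \<or> c \<le> x))"

text \<open>Adding the chosen \<open>c\<close> keeps the elements of \<open>C\<close> non-spanning: any \<open>x \<in> \<tau> - C\<close> lies
  below all of them or above all of them, and is therefore a lower bound other than \<open>0\<close> or an
  upper bound other than \<open>1\<close>.\<close>

lemma insert_comparable_cut_element:
  assumes C: "crosscut C" and \<tau>: "\<tau> \<in> joint_complex C" and one: "1 \<le> card (\<tau> \<inter> - C)"
  shows "comparable_cut_element C (\<tau> \<inter> - C) \<notin> - C \<and>
    insert (comparable_cut_element C (\<tau> \<inter> - C)) \<tau> \<in> joint_complex C"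
proof -
  define \<sigma> where "\<sigma> = \<tau> \<inter> - C"
  define c where "c = comparable_cut_element C \<sigma>"
  have \<tau>': "finite \<tau>" "Orderings.bot \<notin> \<tau>" "Orderings.top \<notin> \<tau>"
    "\<And>x y. x \<in> \<tau> \<Longrightarrow> y \<in> \<tau> \<Longrightarrow> x \<le> y \<or> y \<le> x \<or> x \<in> C \<and> y \<in> C"
    using \<tau> by (auto simp: joint_complex_def)
  have "Complete_Partial_Order.chain (\<le>) \<sigma>"
  proof (rule chainI)
    fix x y assume "x \<in> \<sigma>" "y \<in> \<sigma>"
    then show "x \<le> y \<or> y \<le> x" using \<tau>'(4)[of x y] by (simp add: \<sigma>_def)
  qed
  moreover have "finite \<sigma>" using \<tau>'(1) by (simp add: \<sigma>_def)
  moreover have "\<forall>X. finite X \<and> Complete_Partial_Order.chain (\<le>) X \<longrightarrow>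
      (\<exists>Y. Complete_Partial_Order.chain (\<le>) Y \<and> X \<subseteq> Y \<and> Y \<inter> C \<noteq> {})"
    using C unfolding crosscut_def by (elim conjE)
  ultimately have "\<exists>Y. Complete_Partial_Order.chain (\<le>) Y \<and> \<sigma> \<subseteq> Y \<and> Y \<inter> C \<noteq> {}"
    by (simp only: simp_thms)
  then obtain Y where Y: "Complete_Partial_Order.chain (\<le>) Y" "\<sigma> \<subseteq> Y" "Y \<inter> C \<noteq> {}"
    by (elim exE conjE)
  then obtain b where b: "b \<in> Y" "b \<in> C" by blast
  have "x \<le> b \<or> b \<le> x" if "x \<in> \<sigma>" for x
    using chainD[OF Y(1) _ b(1), of x] Y(2) that by (auto dest: subsetD)
  with b(2) have "b \<in> C \<and> (\<forall>x\<in>\<sigma>. x \<le> b \<or> b \<le> x)" by simp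
  then have "c \<in> C \<and> (\<forall>x\<in>\<sigma>. x \<le> c \<or> c \<le> x)"
    unfolding c_def comparable_cut_element_def
    by (rule someI[of "\<lambda>c. c \<in> C \<and> (\<forall>x\<in>\<sigma>. x \<le> c \<or> c \<le> x)" b])
  then have c: "c \<in> C" "\<And>x. x \<in> \<sigma> \<Longrightarrow> x \<le> c \<or> c \<le> x" by simp_all
  define S where "S = insert c (\<tau> \<inter> C)"
  have S: "finite S" "S \<noteq> {}" "S \<subseteq> C" using \<tau>'(1) c(1) by (auto simp: S_def)
  have "\<sigma> \<noteq> {}" using one by (auto simp: \<sigma>_def)
  then obtain x where x: "x \<in> \<sigma>" by blast
  then have x': "x \<in> \<tau>" "x \<notin> C" "x \<noteq> Orderings.bot" "x \<noteq> Orderings.top"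
    using \<tau>'(2,3) by (auto simp: \<sigma>_def)
  have "(\<forall>d\<in>S. x \<le> d) \<or> (\<forall>d\<in>S. d \<le> x)"
  proof (rule same_side_of_antichain[OF C S(3) x'(2)])
    show "x \<le> d \<or> d \<le> x" if "d \<in> S" for d
      using that \<tau>'(4)[OF x'(1), of d] c(2)[OF x] x'(2) by (auto simp: S_def)
  qed
  then have "x \<le> Inf_fin S \<or> Sup_fin S \<le> x"
    using S by (simp add: Inf_fin.bounded_iff Sup_fin.bounded_iff)
  then have "\<not> spans S" using x'(3,4) by (auto simp: spans_def bot_unique top_unique)
  then have "insert c \<tau> \<inter> C \<in> crosscut_complex C"
    using S c(1) by (simp add: crosscut_complex_def S_def)
  moreover have "x \<le> y \<or> y \<le> x \<or> x \<in> C \<and> y \<in> C" if "x \<in> insert c \<tau>" "y \<in> insert c \<tau>" for x y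
  proof -
    have "c \<le> u \<or> u \<le> c \<or> u \<in> C" if "u \<in> \<tau>" for u using c(2)[of u] that by (auto simp: \<sigma>_def)
    then show ?thesis using that \<tau>'(4)[of x y] c(1) by (elim insertE) auto
  qed
  moreover have "c \<noteq> Orderings.bot" "c \<noteq> Orderings.top" using c(1) crosscutD(1,2)[OF C] by auto
  ultimately have "insert c \<tau> \<in> joint_complex C"
    using \<tau>'(1-3) by (simp add: joint_complex_def)
  then show ?thesis using c(1) by (simp add: c_def \<sigma>_def)
qed

theorem theorem12:
  fixes C :: "'a::bounded_lattice set" and G :: "('a \<Rightarrow> 'a) set" and i :: int
  assumes "subgroup G lattice_Aut"
    and "crosscut C"
    and "\<forall>g\<in>G. g ` C = C"
  shows "\<exists>\<phi>. \<phi> \<in> left_module_iso (group_algebra (lattice_Aut\<lparr>carrier := G\<rparr>))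
    (reduced_homology (order_complex :: 'a set set) i) (reduced_homology (crosscut_complex C) i)"
proof -
  let ?\<Gamma> = "lattice_Aut\<lparr>carrier := G\<rparr>"
  have car: "g \<in> carrier lattice_Aut" if "g \<in> carrier ?\<Gamma>" for g
    using subgroup.subset[OF assms(1)] that by auto
  have bij: "bij g" if "g \<in> carrier ?\<Gamma>" for g using car[OF that] by (rule lattice_AutD(1))
  have C: "g ` C = C" if "g \<in> carrier ?\<Gamma>" for g using assms(3) that by simp
  have "\<forall>\<tau>\<in>joint_complex C. 2 \<le> card (\<tau> \<inter> C) \<longrightarrow>
      meet_or_join (\<tau> \<inter> C) \<notin> C \<and> insert (meet_or_join (\<tau> \<inter> C)) \<tau> \<in> joint_complex C"
    using insert_meet_or_join[OF assms(2)] by simp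
  note L = homology_of_apex_subcomplex[where i = i, OF simplicial_complex_joint_complex this
      order_complex_eq_joint_complex[OF assms(2)]]
  let ?c = "comparable_cut_element C"
  have "\<forall>\<tau>\<in>joint_complex C. 1 \<le> card (\<tau> \<inter> - C) \<longrightarrow>
      ?c (\<tau> \<inter> - C) \<notin> - C \<and> insert (?c (\<tau> \<inter> - C)) \<tau> \<in> joint_complex C"
    using insert_comparable_cut_element[OF assms(2)] by blast
  note K = homology_of_apex_subcomplex[where i = i, OF simplicial_complex_joint_complex this
      crosscut_complex_eq_joint_complex[OF assms(2)]]
  note data = quotient_data_homology[where \<Gamma> = ?\<Gamma> and i = i, OF _ _ bij]
  have "quotient_data (group_algebra ?\<Gamma>) (cycles order_complex i)
      (cycles order_complex i \<inter> boundaries (joint_complex C) i) algebra_act"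
    unfolding L(2)
    by (rule data[OF simplicial_complex_order_complex image_order_complex]) (erule car)
  moreover have "quotient_data (group_algebra ?\<Gamma>) (cycles (crosscut_complex C) i)
      (cycles (crosscut_complex C) i \<inter> boundaries (joint_complex C) i) algebra_act"
    unfolding K(2)
    by (rule data[OF simplicial_complex_crosscut_complex image_crosscut_complex]) (erule car, erule C)
  moreover have "quotient_data (group_algebra ?\<Gamma>) (cycles (joint_complex C) i)
      (boundaries (joint_complex C) i) algebra_act"
    by (rule data[OF simplicial_complex_joint_complex image_joint_complex]) (erule car, erule C)
  ultimately have "\<exists>\<phi>. \<phi> \<in> left_module_iso (group_algebra ?\<Gamma>)
      (quotient_module (cycles order_complex i)
        (cycles order_complex i \<inter> boundaries (joint_complex C) i) algebra_act)
      (quotient_module (cycles (crosscut_complex C) i)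
        (cycles (crosscut_complex C) i \<inter> boundaries (joint_complex C) i) algebra_act)"
    using L(1) K(1) L(3) K(3) by (rule quotient_module_iso_common_overgroup)
  then show ?thesis unfolding reduced_homology_def L(2) K(2) .
qed

end
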